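(* There is an algorithm which, given integers $d,n\ge1$, an $n$-tuple $\mathbf{Q}=(Q_1,\dots,Q_n)$ of real quadratic forms in $d$ variables (given by their coefficients), and integers $0\le d'\le d$, $0\le n'\le n$, computes the number $\mathfrak{d}_{d',n'}(\mathbf{Q})$.
   Context: For a tuple $\mathbf{Q}=(Q_1,\dots,Q_n)$ of quadratic forms in $d$ variables, $NV(\mathbf{Q})$ is the number of indices $1\le i\le d$ such that $\partial_{\xi_i}Q_j\not\equiv0$ for some $1\le j\le n$. For $0\le d'\le d$ and $0\le n'\le n$, $$\mathfrak{d}_{d',n'}(\mathbf{Q})=\inf_{\substack{M\in\mathbb{R}^{d\times d}\\ \mathrm{rank}(M)=d'}}\ \inf_{\substack{M'\in\mathbb{R}^{n\times n}\\ \mathrm{rank}(M')=n'}}NV(M'\cdot(\mathbf{Q}\circ M)),$$ where $M'\cdot(\mathbf{Q}\circ M)$ is the tuple whose $i$-th entry is $\sum_jM'_{ij}\,Q_j(M\xi)$. "Algorithm" means a procedure that terminates after finitely many exact arithmetic operations and sign tests on real numbers. *)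

theory Defs
  imports "HOL-Analysis.Derivative" "Jordan_Normal_Form.DL_Rank"
begin

section \<open>Quadratic forms and the number of variables on which they depend\<close>

text \<open>
  Points of $\mathbb{R}^d$ are vectors in \<open>carrier_vec d\<close>, all indices run from \<open>0\<close>, and an
  \<open>n\<close>-tuple of forms is a function of which only the values at indices below \<open>n\<close> matter.
  A form is given by the coefficients \<open>c i j\<close> (\<open>i \<le> j < d\<close>) of its monomials, and real polynomials
  are identified with the functions that they induce.
\<close>

definition quad_form :: "nat \<Rightarrow> (nat \<Rightarrow> nat \<Rightarrow> real) \<Rightarrow> real vec \<Rightarrow> real" where
  "quad_form d c \<xi> = (\<Sum>i<d. \<Sum>j\<in>{i..<d}. c i j * (\<xi> $ i) * (\<xi> $ j))"

definition partial_deriv :: "nat \<Rightarrow> nat \<Rightarrow> (real vec \<Rightarrow> real) \<Rightarrow> real vec \<Rightarrow> real" where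
  "partial_deriv d i F \<xi> = deriv (\<lambda>t. F (\<xi> + t \<cdot>\<^sub>v unit_vec d i)) 0"

definition NV :: "nat \<Rightarrow> nat \<Rightarrow> (nat \<Rightarrow> real vec \<Rightarrow> real) \<Rightarrow> nat" where
  "NV d n Q = card {i. i < d \<and> (\<exists>j<n. \<exists>\<xi>\<in>carrier_vec d. partial_deriv d i (Q j) \<xi> \<noteq> 0)}"

definition transform ::
    "nat \<Rightarrow> real mat \<Rightarrow> real mat \<Rightarrow> (nat \<Rightarrow> real vec \<Rightarrow> real) \<Rightarrow> nat \<Rightarrow> real vec \<Rightarrow> real" where
  "transform n M' M Q = (\<lambda>i \<xi>. \<Sum>j<n. M' $$ (i, j) * Q j (M *\<^sub>v \<xi>))"

definition rank_mats :: "nat \<Rightarrow> nat \<Rightarrow> real mat set" where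
  "rank_mats m r = {M \<in> carrier_mat m m. vec_space.rank m M = r}"

text \<open>
  The infima are over sets of natural numbers, where \<open>Inf\<close> is the minimum of a nonempty set;
  \<open>rank_mats m r\<close> is nonempty exactly for \<open>r \<le> m\<close>.
\<close>

definition frakd :: "nat \<Rightarrow> nat \<Rightarrow> nat \<Rightarrow> nat \<Rightarrow> (nat \<Rightarrow> real vec \<Rightarrow> real) \<Rightarrow> nat" where
  "frakd d n d' n' Q = (INF M\<in>rank_mats d d'. INF M'\<in>rank_mats n n'. NV d n (transform n M' M Q))"


section \<open>Algorithms over the real numbers\<close>

text \<open>
  Algorithms are first-order recursive programs (in the sense of McCarthy) over the field of real
  numbers.  A datum is a finite binary tree with real numbers at leaves, so that finite sequences
  are available as in the Blum--Shub--Smale model.  The only operations on reals are the exact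
  field operations and the three-way sign test, and the only real constants are \<open>0\<close> and \<open>1\<close>:
  arbitrary real constants would allow a program to carry infinitely much information.
\<close>

datatype obj = Num real | Empty | Cell obj obj

datatype expr =
    Var nat
  | Zero | One
  | Add expr expr | Sub expr expr | Mul expr expr | Div expr expr
  | SignCase expr expr expr expr
  | MkEmpty | MkCell expr expr | Head expr | Tail expr
  | KindCase expr expr expr expr
  | LetIn expr expr
  | Call nat "expr list"

type_synonym program = "expr list"

text \<open>
  A program is the finite list of the bodies of its (mutually recursive) functions.
  \<open>Var i\<close> refers to entry \<open>i\<close> of the environment: in a body the environment initially is the list
  of arguments, and \<open>LetIn\<close> puts a new entry in front.

  \<open>eval P env e v\<close> states that evaluation of \<open>e\<close> terminates with value \<open>v\<close>.  As the relation is
  inductive, a terminating evaluation has only finitely many steps; there is no value if evaluation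
  diverges or gets stuck (division by zero, ill-typed argument, unbound variable, unknown function).
\<close>

inductive eval :: "program \<Rightarrow> obj list \<Rightarrow> expr \<Rightarrow> obj \<Rightarrow> bool" for P :: program where
  Var: "i < length env \<Longrightarrow> eval P env (Var i) (env ! i)"
| Zero: "eval P env Zero (Num 0)"
| One: "eval P env One (Num 1)"
| Add: "eval P env a (Num x) \<Longrightarrow> eval P env b (Num y) \<Longrightarrow> eval P env (Add a b) (Num (x + y))"
| Sub: "eval P env a (Num x) \<Longrightarrow> eval P env b (Num y) \<Longrightarrow> eval P env (Sub a b) (Num (x - y))"
| Mul: "eval P env a (Num x) \<Longrightarrow> eval P env b (Num y) \<Longrightarrow> eval P env (Mul a b) (Num (x * y))"
| Div: "eval P env a (Num x) \<Longrightarrow> eval P env b (Num y) \<Longrightarrow> y \<noteq> 0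
    \<Longrightarrow> eval P env (Div a b) (Num (x / y))"
| SignNeg: "eval P env a (Num x) \<Longrightarrow> x < 0 \<Longrightarrow> eval P env e1 v
    \<Longrightarrow> eval P env (SignCase a e1 e2 e3) v"
| SignZero: "eval P env a (Num x) \<Longrightarrow> x = 0 \<Longrightarrow> eval P env e2 v
    \<Longrightarrow> eval P env (SignCase a e1 e2 e3) v"
| SignPos: "eval P env a (Num x) \<Longrightarrow> x > 0 \<Longrightarrow> eval P env e3 v
    \<Longrightarrow> eval P env (SignCase a e1 e2 e3) v"
| MkEmpty: "eval P env MkEmpty Empty"
| MkCell: "eval P env a v \<Longrightarrow> eval P env b w \<Longrightarrow> eval P env (MkCell a b) (Cell v w)"
| Head: "eval P env a (Cell v w) \<Longrightarrow> eval P env (Head a) v"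
| Tail: "eval P env a (Cell v w) \<Longrightarrow> eval P env (Tail a) w"
| KindNum: "eval P env a (Num x) \<Longrightarrow> eval P env e1 v \<Longrightarrow> eval P env (KindCase a e1 e2 e3) v"
| KindEmpty: "eval P env a Empty \<Longrightarrow> eval P env e2 v \<Longrightarrow> eval P env (KindCase a e1 e2 e3) v"
| KindCell: "eval P env a (Cell u w) \<Longrightarrow> eval P env e3 v \<Longrightarrow> eval P env (KindCase a e1 e2 e3) v"
| LetIn: "eval P env a u \<Longrightarrow> eval P (u # env) b v \<Longrightarrow> eval P env (LetIn a b) v"
| Call: "f < length P \<Longrightarrow> list_all2 (eval P env) es vs \<Longrightarrow> eval P vs (P ! f) v
    \<Longrightarrow> eval P env (Call f es) v"

inductive_cases eval_elims:
  "eval P env (Var i) w"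
  "eval P env Zero w"
  "eval P env One w"
  "eval P env (Add a b) w"
  "eval P env (Sub a b) w"
  "eval P env (Mul a b) w"
  "eval P env (Div a b) w"
  "eval P env (SignCase a e1 e2 e3) w"
  "eval P env MkEmpty w"
  "eval P env (MkCell a b) w"
  "eval P env (Head a) w"
  "eval P env (Tail a) w"
  "eval P env (KindCase a e1 e2 e3) w"
  "eval P env (LetIn a b) w"
  "eval P env (Call f es) w"

lemma eval_deterministic: "eval P env e v \<Longrightarrow> eval P env e w \<Longrightarrow> v = w"
proof (induction arbitrary: w rule: eval.induct)
  case (Call f env es vs v)
  from Call.prems obtain vs' where vs': "list_all2 (eval P env) es vs'" "eval P vs' (P ! f) w"
    by (elim eval_elims)
  have len: "length vs = length vs'"
    using Call.IH(1) vs'(1) by (simp add: list_all2_conv_all_nth)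
  have "vs ! i = vs' ! i" if "i < length vs" for i
    using that Call.IH(1) vs'(1) by (simp add: list_all2_conv_all_nth)
  with len have "vs = vs'" by (simp add: list_eq_iff_nth_eq)
  with vs'(2) Call.IH(2) show ?case by simp
qed (elim eval_elims; metis obj.inject obj.distinct less_irrefl less_asym)+

text \<open>Execution starts with the first function of the program.\<close>

definition computes :: "program \<Rightarrow> obj list \<Rightarrow> real \<Rightarrow> bool" where
  "computes P args r \<longleftrightarrow> P \<noteq> [] \<and> eval P args (hd P) (Num r)"

fun enc_list :: "obj list \<Rightarrow> obj" where
  "enc_list [] = Empty"
| "enc_list (v # vs) = Cell v (enc_list vs)"

text \<open>
  Integers are passed as real numbers.  The coefficients of the tuple with entries
  \<open>quad_form d (c k)\<close>, \<open>k < n\<close>, are passed as a list of upper triangular tables.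
\<close>

definition enc_coeffs :: "nat \<Rightarrow> nat \<Rightarrow> (nat \<Rightarrow> nat \<Rightarrow> nat \<Rightarrow> real) \<Rightarrow> obj" where
  "enc_coeffs d n c =
    enc_list (map (\<lambda>k. enc_list (map (\<lambda>i. enc_list (map (\<lambda>j. Num (c k i j)) [i..<d])) [0..<d])) [0..<n])"

end

theory Submission
  imports Defs "HOL-Computational_Algebra.Polynomial"
begin

text \<open>
  Up to row operations and a change of coordinates, \<open>frakd d n d' n' Q \<le> m\<close> means that there are \<open>d'\<close> independent
  vectors and \<open>n'\<close> independent combinations of the forms such that all but \<open>m\<close> of the vectors lie in the
  common kernel of the combinations restricted to the span.  As independence is the existence
  of a one-sided inverse, this is the solvability of a system of polynomial equations over the reals,
  which is decided by eliminating the variables one by one.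

  To eliminate \<open>x\<close> (Cohen--Hoermander, Muchnik), the polynomials in \<open>x\<close> are closed under deletion of the leading
  term, differentiation and pseudo-remainders.  Given the signs of all leading coefficients, the table
  of signs on the real line is built by adding the polynomials in the order of their degrees: at a root
  of a former polynomial the sign of the new one is that of the pseudo-remainder, and between the
  roots the new polynomial is monotone.

  Programs are never written down.  Functions on encoded data are computable
  if some program computes them; this property is closed under composition and well-founded recursion.
\<close>

section \<open>Computable functions\<close>

text \<open>One program serves all \<open>d\<close> and \<open>n\<close>, so the number of unknowns
  is itself an input and polynomials are data whose nesting depth is fixed only at run time. The
  obstacle in eliminating a variable is that the remaining ones are unknown: true degrees,
  remainders and roots all depend on them. The construction therefore works with formal degrees and
  without division. The list of polynomials is computed from the system alone, and the parameters
  enter only through the signs of finitely many leading coefficients. Solvability in the eliminated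
  variable is a function of these signs, so it can be tested for each sign pattern without knowing a
  point where the pattern occurs. The number itself then costs only \<open>d'\<close> decisions: its
  value is at most \<open>d'\<close>, and the condition that it is at most \<open>m\<close> is
  monotone in \<open>m\<close>, so the failures among the \<open>m\<close> below \<open>d'\<close>
  are counted.\<close>

class encodable =
  fixes enc :: "'a \<Rightarrow> obj"
  assumes inj_enc: "inj enc"

lemma enc_eq_iff [simp]: "enc x = enc y \<longleftrightarrow> x = y"
  using inj_enc by (auto dest: injD)

instantiation obj :: encodable
begin
definition enc_obj :: "obj \<Rightarrow> obj" where [simp]: "enc_obj v = v"
instance by standard (simp add: inj_def)
end

instantiation real :: encodable
begin
definition enc_real :: "real \<Rightarrow> obj" where [simp]: "enc_real = Num"
instance by standard (simp add: inj_def)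
end

instantiation nat :: encodable
begin
definition enc_nat :: "nat \<Rightarrow> obj" where [simp]: "enc_nat k = Num (real k)"
instance by standard (simp add: inj_def)
end

instantiation bool :: encodable
begin
definition enc_bool :: "bool \<Rightarrow> obj" where [simp]: "enc_bool b = Num (if b then 1 else 0)"
instance by standard (simp add: inj_def)
end

instantiation prod :: (encodable, encodable) encodable
begin
definition enc_prod :: "'a \<times> 'b \<Rightarrow> obj" where [simp]: "enc_prod p = Cell (enc (fst p)) (enc (snd p))"
instance by standard (auto simp: inj_def)
end

instantiation list :: (encodable) encodable
begin
definition enc_list :: "'a list \<Rightarrow> obj" where "enc_list xs = Defs.enc_list (map enc xs)"
instance
proof
  have "Defs.enc_list (map enc xs) = Defs.enc_list (map enc ys) \<Longrightarrow> xs = ys" for xs ys :: "'a list"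
  proof (induction xs arbitrary: ys)
    case Nil then show ?case by (cases ys) auto
  next
    case (Cons x xs) then show ?case by (cases ys) auto
  qed
  then show "inj (enc :: 'a list \<Rightarrow> obj)" by (auto simp: inj_def enc_list_def)
qed
end

lemma enc_Nil [simp]: "enc [] = Empty"
  and enc_Cons [simp]: "enc (x # xs) = Cell (enc x) (enc xs)"
  by (simp_all add: enc_list_def)

section \<open>Joining programs\<close>

fun relocate :: "nat \<Rightarrow> expr \<Rightarrow> expr" where
  "relocate k (Var i) = Var i"
| "relocate k Zero = Zero"
| "relocate k One = One"
| "relocate k (Add a b) = Add (relocate k a) (relocate k b)"
| "relocate k (Sub a b) = Sub (relocate k a) (relocate k b)"
| "relocate k (Mul a b) = Mul (relocate k a) (relocate k b)"
| "relocate k (Div a b) = Div (relocate k a) (relocate k b)"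
| "relocate k (SignCase a b c d) = SignCase (relocate k a) (relocate k b) (relocate k c) (relocate k d)"
| "relocate k MkEmpty = MkEmpty"
| "relocate k (MkCell a b) = MkCell (relocate k a) (relocate k b)"
| "relocate k (Head a) = Head (relocate k a)"
| "relocate k (Tail a) = Tail (relocate k a)"
| "relocate k (KindCase a b c d) = KindCase (relocate k a) (relocate k b) (relocate k c) (relocate k d)"
| "relocate k (LetIn a b) = LetIn (relocate k a) (relocate k b)"
| "relocate k (Call f es) = Call (k + f) (map (relocate k) es)"

lemma eval_append: "eval P env e v \<Longrightarrow> eval (P @ R) env e v"
proof (induction rule: eval.induct)
  case (Call f env es vs v)
  have "list_all2 (eval (P @ R) env) es vs"
    using Call.IH(1) by (rule list_all2_mono) blast
  with Call show ?case
    by (intro eval.Call[where vs = vs]) (auto simp: nth_append)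
qed (auto intro: eval.intros)

lemma eval_relocate:
  "eval P env e v \<Longrightarrow> eval (A @ map (relocate (length A)) P) env (relocate (length A) e) v"
proof (induction rule: eval.induct)
  case (Call f env es vs v)
  have "list_all2 (eval (A @ map (relocate (length A)) P) env) (map (relocate (length A)) es) vs"
    unfolding list_all2_map1 using Call.IH(1) by (rule list_all2_mono) blast
  with Call show ?case
    by (auto intro!: eval.Call[where vs = vs] simp: nth_append)
qed (auto intro: eval.intros)

text \<open>All arguments travel as one encoded value, and the equation is demanded for every
  \<open>x\<close> of the type; accesses that may fail are therefore given default values, as in
  \<open>lookup\<close> and \<open>nth_default\<close>.\<close>

definition implements :: "program \<Rightarrow> nat \<Rightarrow> ('a::encodable \<Rightarrow> 'b::encodable) \<Rightarrow> bool" where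
  "implements P k f \<longleftrightarrow> k < length P \<and> (\<forall>x. eval P [enc x] (P ! k) (enc (f x)))"

definition computable :: "('a::encodable \<Rightarrow> 'b::encodable) \<Rightarrow> bool" where
  "computable f \<longleftrightarrow> (\<exists>P k. implements P k f)"

lemma eval_Call1:
  "implements P k f \<Longrightarrow> eval P env a (enc x) \<Longrightarrow> eval P env (Call k [a]) (enc (f x))"
  unfolding implements_def by (auto intro!: eval.Call[where vs = "[enc x]"])

lemma implements_append: "implements P k f \<Longrightarrow> implements (P @ R) k f"
  by (auto simp: implements_def nth_append eval_append)

lemma implements_relocate:
  "implements P k f \<Longrightarrow> implements (A @ map (relocate (length A)) P) (length A + k) f"
  by (auto simp: implements_def nth_append eval_relocate)

text \<open>Functions are addressed by position. The code of \<open>f\<close> comes first and keeps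
  its addresses, that of \<open>g\<close> is appended with its call targets shifted by
  \<open>relocate\<close>. A common program lets a new body call both.\<close>

lemma computable_cases2:
  assumes "computable f" "computable g"
  obtains P k l where "implements P k f" "implements P l g"
  using assms unfolding computable_def by (meson implements_append implements_relocate)

lemma computable_cases3:
  assumes "computable f" "computable g" "computable h"
  obtains P k l m where "implements P k f" "implements P l g" "implements P m h"
  using computable_cases2[OF assms(1,2)] assms(3) unfolding computable_def
  by (metis implements_append implements_relocate)

lemma computable_cases4:
  assumes "computable f" "computable g" "computable h" "computable i"
  obtains P k l m n where "implements P k f" "implements P l g" "implements P m h" "implements P n i"
  using computable_cases3[OF assms(1-3)] assms(4) unfolding computable_def
  by (metis implements_append implements_relocate)

lemma computableI: "(\<And>x. eval (P @ [b]) [enc x] b (enc (f x))) \<Longrightarrow> computable f"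
  unfolding computable_def implements_def by (auto intro!: exI[of _ "P @ [b]"] exI[of _ "length P"])

lemma computableI0: "(\<And>x. eval [b] [enc x] b (enc (f x))) \<Longrightarrow> computable f"
  using computableI[of "[]" b f] by simp

lemma eval_Var0: "eval P (v # env) (Var 0) v"
  using eval.Var[of 0 "v # env"] by simp

lemmas eval_step = eval.intros(2-) eval_Var0 eval_Call1[OF implements_append]

named_theorems computable_intros

lemma computable_id [computable_intros]: "computable (\<lambda>x. x)"
  by (rule computableI0[of "Var 0"]) (rule eval_Var0)

text \<open>Programs see only encodings, so even the result type may change: naturals are handled as
  reals, and a list cell as a pair.\<close>

lemma computable_transfer:
  assumes "computable f" "\<And>x. enc (f x) = enc (g x)"
  shows "computable g"
  using assms unfolding computable_def implements_def by auto

lemma computable_comp: "computable g \<Longrightarrow> computable f \<Longrightarrow> computable (\<lambda>x. g (f x))"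
  by (erule (1) computable_cases2, rule computableI[of _ "Call _ [Call _ [Var 0]]"])
    (rule eval_Call1[OF implements_append eval_Call1[OF implements_append eval_Var0]])

lemma computable_Pair [computable_intros]:
  "computable f \<Longrightarrow> computable g \<Longrightarrow> computable (\<lambda>x. (f x, g x))"
  by (erule (1) computable_cases2, rule computableI[of _ "MkCell (Call _ [Var 0]) (Call _ [Var 0])"])
    (simp, rule eval.MkCell; rule eval_Call1[OF implements_append eval_Var0]; assumption)

lemma computable_fst [computable_intros]: "computable f \<Longrightarrow> computable (\<lambda>x. fst (f x))"
  by (rule computable_comp[of fst], rule computableI0[of "Head (Var 0)"])
    (auto intro: eval_step)

lemma computable_snd [computable_intros]: "computable f \<Longrightarrow> computable (\<lambda>x. snd (f x))"
  by (rule computable_comp[of snd], rule computableI0[of "Tail (Var 0)"])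
    (auto intro: eval_step)

lemma computable_case_prod [computable_intros]:
  "computable (\<lambda>x. g x (fst (f x)) (snd (f x))) \<Longrightarrow> computable (\<lambda>x. case f x of (a, b) \<Rightarrow> g x a b)"
  by (simp add: case_prod_unfold)

lemma computable_comp2:
  assumes "computable (\<lambda>z. h (fst z) (snd z))" "computable f" "computable g"
  shows "computable (\<lambda>x. h (f x) (g x))"
  using computable_comp[OF assms(1) computable_Pair[OF assms(2,3)]] by simp

lemma computable_comp3:
  assumes "computable (\<lambda>z. h (fst z) (fst (snd z)) (snd (snd z)))"
    "computable f" "computable g" "computable i"
  shows "computable (\<lambda>x. h (f x) (g x) (i x))"
  using computable_comp[OF assms(1) computable_Pair[OF assms(2) computable_Pair[OF assms(3,4)]]]
  by simp

lemma computable_zero [computable_intros]: "computable (\<lambda>x. 0 :: real)"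
  and computable_one [computable_intros]: "computable (\<lambda>x. 1 :: real)"
  and computable_zero_nat [computable_intros]: "computable (\<lambda>x. 0 :: nat)"
  and computable_one_nat [computable_intros]: "computable (\<lambda>x. 1 :: nat)"
  and computable_True [computable_intros]: "computable (\<lambda>x. True)"
  and computable_False [computable_intros]: "computable (\<lambda>x. False)"
  and computable_Nil [computable_intros]: "computable (\<lambda>x. [] :: 'a::encodable list)"
  and computable_Empty [computable_intros]: "computable (\<lambda>x. Empty)"
          apply (rule computableI0[of Zero], auto intro: eval_step)
         apply (rule computableI0[of One], auto intro: eval_step)
        apply (rule computableI0[of Zero], auto intro: eval_step)
       apply (rule computableI0[of One], auto intro: eval_step)
      apply (rule computableI0[of One], auto intro: eval_step)
    apply (rule computableI0[of Zero], auto intro: eval_step)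
   apply (rule computableI0[of MkEmpty], auto intro: eval_step)
  apply (rule computableI0[of MkEmpty], auto intro: eval_step)
  done

lemma computable_real_binop:
  fixes f g :: "'a::encodable \<Rightarrow> real"
  assumes "computable f" "computable g"
  shows "computable (\<lambda>x. f x + g x)" "computable (\<lambda>x. f x - g x)" "computable (\<lambda>x. f x * g x)"
    "computable (\<lambda>x. f x < g x)" "computable (\<lambda>x. f x = g x)"
proof -
  obtain P k l where P: "implements P k f" "implements P l g"
    using computable_cases2[OF assms] .
  let ?a = "Call k [Var 0]" and ?b = "Call l [Var 0]"
  have a: "eval (P @ R) [enc x] ?a (Num (f x))" for x R
    using eval_Call1[OF implements_append[OF P(1)] eval_Var0, where env1 = "[]"] by simp
  have b: "eval (P @ R) [enc x] ?b (Num (g x))" for x R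
    using eval_Call1[OF implements_append[OF P(2)] eval_Var0, where env1 = "[]"] by simp
  note ab = eval.Sub[OF a b]
  show "computable (\<lambda>x. f x + g x)"
    by (rule computableI[of P "Add ?a ?b"]) (auto intro: eval.intros a b)
  show "computable (\<lambda>x. f x - g x)"
    by (rule computableI[of P "Sub ?a ?b"]) (auto intro: eval.intros a b)
  show "computable (\<lambda>x. f x * g x)"
    by (rule computableI[of P "Mul ?a ?b"]) (auto intro: eval.intros a b)
  show "computable (\<lambda>x. f x < g x)"
  proof (rule computableI[of P "SignCase (Sub ?a ?b) One Zero Zero"])
    fix x show "eval (P @ [SignCase (Sub ?a ?b) One Zero Zero]) [enc x] (SignCase (Sub ?a ?b) One Zero Zero) (enc (f x < g x))"
      using eval.SignNeg[OF ab _ eval.One] eval.SignZero[OF ab _ eval.Zero] eval.SignPos[OF ab _ eval.Zero]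
      by (cases "f x" "g x" rule: linorder_cases) auto
  qed
  show "computable (\<lambda>x. f x = g x)"
  proof (rule computableI[of P "SignCase (Sub ?a ?b) Zero One Zero"])
    fix x show "eval (P @ [SignCase (Sub ?a ?b) Zero One Zero]) [enc x] (SignCase (Sub ?a ?b) Zero One Zero) (enc (f x = g x))"
      using eval.SignNeg[OF ab _ eval.Zero] eval.SignZero[OF ab _ eval.One] eval.SignPos[OF ab _ eval.Zero]
      by (cases "f x" "g x" rule: linorder_cases) auto
  qed
qed

lemmas computable_add [computable_intros] = computable_real_binop(1)
  and computable_diff [computable_intros] = computable_real_binop(2)
  and computable_mult [computable_intros] = computable_real_binop(3)
  and computable_less [computable_intros] = computable_real_binop(4)
  and computable_eq_real = computable_real_binop(5)

lemma computable_uminus [computable_intros]: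
  "computable f \<Longrightarrow> computable (\<lambda>x. - f x :: real)"
  using computable_diff[OF computable_zero] by simp

lemma computable_if [computable_intros]:
  assumes "computable b" "computable f" "computable g"
  shows "computable (\<lambda>x. if b x then f x else g x)"
proof -
  obtain P k l m where P: "implements P k b" "implements P l f" "implements P m g"
    using computable_cases3[OF assms] .
  \<comment> \<open>Booleans are encoded as 1 and 0, so the branch for negative values is never
    taken and \<open>MkEmpty\<close> merely fills it.\<close>
  let ?e = "SignCase (Call k [Var 0]) MkEmpty (Call m [Var 0]) (Call l [Var 0])"
  have b: "eval (P @ R) [enc x] (Call k [Var 0]) (Num (if b x then 1 else 0))" for x R
    using eval_Call1[OF implements_append[OF P(1)] eval_Var0, where env1 = "[]"] by simp
  have "eval (P @ [?e]) [enc x] ?e (enc (if b x then f x else g x))" for x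
    using eval.SignPos[OF b _ eval_Call1[OF implements_append[OF P(2)] eval_Var0]]
      eval.SignZero[OF b _ eval_Call1[OF implements_append[OF P(3)] eval_Var0]]
    by auto
  then show ?thesis by (rule computableI)
qed

lemma computable_Not [computable_intros]: "computable f \<Longrightarrow> computable (\<lambda>x. \<not> f x)"
  by (drule computable_if[OF _ computable_False computable_True], erule computable_transfer) simp

lemma computable_conj [computable_intros]:
  "computable f \<Longrightarrow> computable g \<Longrightarrow> computable (\<lambda>x. f x \<and> g x)"
  by (drule (1) computable_if[OF _ _ computable_False], erule computable_transfer) simp

lemma computable_real_of_nat [computable_intros]: "computable f \<Longrightarrow> computable (\<lambda>x. real (f x))"
  by (erule computable_transfer) simp

lemma computable_nat_binop:
  fixes f g :: "'a::encodable \<Rightarrow> nat"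
  assumes [computable_intros]: "computable f" "computable g"
  shows computable_add_nat: "computable (\<lambda>x. f x + g x)"
    and computable_mult_nat: "computable (\<lambda>x. f x * g x)"
    and computable_less_nat: "computable (\<lambda>x. f x < g x)"
    and computable_diff_nat: "computable (\<lambda>x. f x - g x)"
proof -
  have "computable (\<lambda>x. real (f x) + real (g x))" by (intro computable_intros)
  then show "computable (\<lambda>x. f x + g x)" by (rule computable_transfer) simp
  have "computable (\<lambda>x. real (f x) * real (g x))" by (intro computable_intros)
  then show "computable (\<lambda>x. f x * g x)" by (rule computable_transfer) simp
  have "computable (\<lambda>x. real (f x) < real (g x))" by (intro computable_intros)
  then show "computable (\<lambda>x. f x < g x)" by (rule computable_transfer) simp
  have "computable (\<lambda>x. if real (f x) < real (g x) then 0 else real (f x) - real (g x))"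
    by (intro computable_intros)
  then show "computable (\<lambda>x. f x - g x)" by (rule computable_transfer) (simp add: of_nat_diff)
qed

lemmas [computable_intros] =
  computable_add_nat computable_mult_nat computable_less_nat computable_diff_nat

lemma computable_Suc [computable_intros]: "computable f \<Longrightarrow> computable (\<lambda>x. Suc (f x))"
  using computable_add_nat[OF _ computable_one_nat] by simp

lemma computable_case_nat [computable_intros]:
  assumes "computable n" "computable a" "computable (\<lambda>z. b (fst z) (snd z))"
  shows "computable (\<lambda>x. case n x of 0 \<Rightarrow> a x | Suc k \<Rightarrow> b x k)"
proof -
  have "computable (\<lambda>x. b x (n x - 1))"
    by (rule computable_comp2[OF assms(3)]) (intro computable_intros assms)+
  then have "computable (\<lambda>x. if 0 < n x then b x (n x - 1) else a x)"
    by (intro computable_intros assms)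
  then show ?thesis by (rule computable_transfer) (auto split: nat.split)
qed

lemma computable_Cons [computable_intros]:
  assumes "computable f" "computable g" shows "computable (\<lambda>x. f x # g x)"
  using computable_Pair[OF assms] by (rule computable_transfer) simp

lemma computable_Cell [computable_intros]:
  assumes "computable f" "computable g" shows "computable (\<lambda>x. Cell (f x) (g x))"
  using computable_Pair[OF assms] by (rule computable_transfer) simp

lemma computable_Num [computable_intros]: "computable f \<Longrightarrow> computable (\<lambda>x. Num (f x))"
  by (erule computable_transfer) simp

lemma computable_case_obj [computable_intros]:
  assumes "computable t" "computable (\<lambda>z. a (fst z) (snd z))" "computable b"
    "computable (\<lambda>z. c (fst z) (fst (snd z)) (snd (snd z)))"
  shows "computable (\<lambda>x. case t x of Num r \<Rightarrow> a x r | Empty \<Rightarrow> b x | Cell u v \<Rightarrow> c x u v)"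
proof -
  obtain P k l m n where P: "implements P k t" "implements P l (\<lambda>z. a (fst z) (snd z))"
    "implements P m b" "implements P n (\<lambda>z. c (fst z) (fst (snd z)) (snd (snd z)))"
    using computable_cases4[OF assms] .
  let ?t = "Call k [Var 0]"
  \<comment> \<open>\<open>KindCase\<close> binds no components: a branch that needs them evaluates
    \<open>?t\<close> again and passes the parts together with \<open>x\<close>.\<close>
  let ?e = "KindCase ?t (Call l [MkCell (Var 0) ?t]) (Call m [Var 0])
      (Call n [MkCell (Var 0) (MkCell (Head ?t) (Tail ?t))])"
  let ?P = "P @ [?e]"
  note P' = P[THEN implements_append[where R = "[?e]"]]
  have "eval ?P [enc x] ?e (enc (case t x of Num r \<Rightarrow> a x r | Empty \<Rightarrow> b x | Cell u v \<Rightarrow> c x u v))" for x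
  proof -
    have t: "eval ?P [enc x] ?t (t x)" using eval_Call1[OF P'(1) eval_Var0, where env1 = "[]"] by simp
    show ?thesis
    proof (cases "t x")
      case (Num r)
      then have "eval ?P [enc x] (MkCell (Var 0) ?t) (enc (x, r))"
        using t by (auto intro: eval.MkCell eval_Var0)
      from eval_Call1[OF P'(2) this] show ?thesis using Num t by (auto intro: eval.KindNum)
    next
      case Empty
      then show ?thesis using t eval_Call1[OF P'(3) eval_Var0] by (auto intro: eval.KindEmpty)
    next
      case (Cell u v)
      have "eval ?P [enc x] (MkCell (Var 0) (MkCell (Head ?t) (Tail ?t))) (enc (x, u, v))"
        using Cell t by (auto intro!: eval.MkCell eval_Var0 intro: eval.Head eval.Tail)
      from eval_Call1[OF P'(4) this] show ?thesis using Cell t by (auto intro: eval.KindCell)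
    qed
  qed
  then show ?thesis by (rule computableI)
qed

lemma computable_case_list [computable_intros]:
  assumes "computable t" "computable a"
    "computable (\<lambda>z. b (fst z) (fst (snd z)) (snd (snd z)))"
  shows "computable (\<lambda>x. case t x of [] \<Rightarrow> a x | y # ys \<Rightarrow> b x y ys)"
proof -
  obtain P k l m where P: "implements P k t" "implements P l a"
    "implements P m (\<lambda>z. b (fst z) (fst (snd z)) (snd (snd z)))"
    using computable_cases3[OF assms] .
  let ?t = "Call k [Var 0]"
  let ?e = "KindCase ?t MkEmpty (Call l [Var 0])
      (Call m [MkCell (Var 0) (MkCell (Head ?t) (Tail ?t))])"
  let ?P = "P @ [?e]"
  note P' = P[THEN implements_append[where R = "[?e]"]]
  have "eval ?P [enc x] ?e (enc (case t x of [] \<Rightarrow> a x | y # ys \<Rightarrow> b x y ys))" for x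
  proof -
    have t: "eval ?P [enc x] ?t (enc (t x))" using eval_Call1[OF P'(1) eval_Var0] .
    show ?thesis
    proof (cases "t x")
      case Nil
      then show ?thesis using t eval_Call1[OF P'(2) eval_Var0] by (auto intro: eval.KindEmpty)
    next
      case (Cons y ys)
      have "eval ?P [enc x] (MkCell (Var 0) (MkCell (Head ?t) (Tail ?t))) (enc (x, y, ys))"
        using Cons t by (auto intro!: eval.MkCell eval_Var0 intro: eval.Head eval.Tail)
      from eval_Call1[OF P'(3) this] show ?thesis using Cons t by (auto intro: eval.KindCell)
    qed
  qed
  then show ?thesis by (rule computableI)
qed

text \<open>
  Divide and conquer.  Structural recursion in several arguments is the special case where \<open>'a\<close> is a
  product.
\<close>

lemma computable_rec:
  fixes f :: "'a::encodable \<Rightarrow> 'b::encodable"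
  assumes "computable d" "computable c" "wf R" "\<And>x y. y \<in> set (d x) \<Longrightarrow> (y, x) \<in> R"
    and f: "\<And>x. f x = c (x, map f (d x))"
  shows "computable f"
proof -
  obtain P k l where P: "implements P k d" "implements P l c"
    using computable_cases2[OF assms(1,2)] .
  let ?n = "length P"
  \<comment> \<open>\<open>F\<close> computes \<open>f\<close> and \<open>G\<close> computes
    \<open>map f\<close>. \<open>F\<close> calls \<open>G\<close>, while \<open>G\<close> calls
    \<open>F\<close> and itself; they sit right behind the code of \<open>d\<close> and
    \<open>c\<close>.\<close>
  define F where "F = Call l [MkCell (Var 0) (Call (Suc ?n) [Call k [Var 0]])]"
  define G where "G = KindCase (Var 0) MkEmpty MkEmpty
    (MkCell (Call ?n [Head (Var 0)]) (Call (Suc ?n) [Tail (Var 0)]))"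
  let ?P = "P @ [F, G]"
  note P' = P[THEN implements_append[where R = "[F, G]"]]
  have nth: "?P ! ?n = F" "?P ! Suc ?n = G" by (auto simp: nth_append)
  have "eval ?P [enc x] F (enc (f x))" for x
    using assms(3)
  proof (induction x rule: wf_induct_rule)
    case (less x)
    have "\<forall>y\<in>set ys. eval ?P [enc y] F (enc (f y)) \<Longrightarrow> eval ?P [enc ys] G (enc (map f ys))" for ys
    proof (induction ys)
      case Nil
      then show ?case unfolding G_def using eval.KindEmpty[OF eval_Var0 eval.MkEmpty] by simp
    next
      case (Cons y ys)
      have 1: "eval ?P [enc (y # ys)] (Call ?n [Head (Var 0)]) (enc (f y))"
        using Cons.prems nth by (auto intro!: eval.Call[where vs = "[enc y]"] eval.Head[OF eval_Var0])
      have 2: "eval ?P [enc (y # ys)] (Call (Suc ?n) [Tail (Var 0)]) (enc (map f ys))"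
        using Cons nth by (auto intro!: eval.Call[where vs = "[enc ys]"] eval.Tail[OF eval_Var0])
      have "eval ?P [Cell (enc y) (enc ys)] (Var 0) (Cell (enc y) (enc ys))" by (rule eval_Var0)
      from eval.KindCell[OF this eval.MkCell[OF 1[simplified] 2[simplified]]]
      show ?case unfolding G_def by simp
    qed
    moreover have "eval ?P [enc y] F (enc (f y))" if "y \<in> set (d x)" for y
      using less assms(4) that by blast
    ultimately have "eval ?P [enc (d x)] G (enc (map f (d x)))" by blast
    then have "eval ?P [enc x] (Call (Suc ?n) [Call k [Var 0]]) (enc (map f (d x)))"
      using nth eval_Call1[OF P'(1) eval_Var0]
      by (intro eval.Call[where vs = "[enc (d x)]"]) auto
    then have "eval ?P [enc x] (MkCell (Var 0) (Call (Suc ?n) [Call k [Var 0]])) (enc (x, map f (d x)))"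
      by (auto intro: eval.MkCell eval_Var0)
    from eval_Call1[OF P'(2) this] show ?case by (simp add: F_def f[of x])
  qed
  then have "implements ?P ?n f" unfolding implements_def nth by simp
  then show ?thesis unfolding computable_def by blast
qed

section \<open>Recursion on lists and natural numbers\<close>

lemma computable_rec_list:
  assumes "computable l" "computable a"
    "computable (\<lambda>z. b (fst z) (fst (snd z)) (fst (snd (snd z))) (snd (snd (snd z))))"
  shows "computable (\<lambda>x. rec_list (a x) (b x) (l x))"
proof -
  let ?f = "\<lambda>(x, ys). rec_list (a x) (b x) ys"
  let ?d = "\<lambda>z. case snd z of [] \<Rightarrow> [] | y # ys \<Rightarrow> [(fst z, ys)]"
  \<comment> \<open>The recursive results arrive as the list \<open>snd w\<close>, a singleton in
    the case \<open>y # ys\<close>. The branch for an empty result list is unreachable and filled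
    arbitrarily, as in the similar functions below.\<close>
  let ?c = "\<lambda>w. case snd (fst w) of [] \<Rightarrow> a (fst (fst w))
    | y # ys \<Rightarrow> (case snd w of [] \<Rightarrow> a (fst (fst w)) | r # rs \<Rightarrow> b (fst (fst w)) y ys r)"
  have a: "computable (\<lambda>x. a (g x))" if "computable g" for g :: "'d::encodable \<Rightarrow> 'a"
    using computable_comp[OF assms(2) that] .
  have b: "computable (\<lambda>x. b (g x) (h x) (i x) (j x))"
    if "computable g" "computable h" "computable i" "computable j"
    for g :: "'d::encodable \<Rightarrow> 'a" and h i j
    using computable_comp[OF assms(3) computable_Pair[OF that(1) computable_Pair[OF that(2)
          computable_Pair[OF that(3,4)]]]] by simp
  have "computable ?f"
  proof (rule computable_rec[where d = ?d and c = ?c])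
    show "computable ?d" by (intro computable_intros)
    show "computable ?c" by (intro computable_intros a b)
    show "wf (measure (\<lambda>z. length (snd z)))" by simp
    show "(y, x) \<in> measure (\<lambda>z. length (snd z))" if "y \<in> set (?d x)" for x y
      using that by (cases "snd x") auto
    show "?f x = ?c (x, map ?f (?d x))" for x
      by (auto split: list.splits prod.splits)
  qed
  from computable_comp[OF this computable_Pair[OF computable_id assms(1)]] show ?thesis by simp
qed

lemma computable_list_recursion:
  assumes "computable l" "computable a"
    "computable (\<lambda>z. b (fst z) (fst (snd z)) (fst (snd (snd z))) (snd (snd (snd z))))"
    and "\<And>x. f x [] = a x" "\<And>x y ys. f x (y # ys) = b x y ys (f x ys)"
  shows "computable (\<lambda>x. f x (l x))"
proof -
  have "f x ys = rec_list (a x) (b x) ys" for x ys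
    by (induction ys) (simp_all add: assms)
  with computable_rec_list[OF assms(1-3)] show ?thesis by simp
qed

lemma computable_append [computable_intros]:
  assumes "computable f" "computable g"
  shows "computable (\<lambda>x. f x @ g x)"
  by (rule computable_list_recursion[OF assms, where f = "\<lambda>x ys. ys @ g x" and b = "\<lambda>x y ys r. y # r"])
    (intro computable_intros, auto)

lemma computable_map [computable_intros]:
  assumes "computable (\<lambda>z. h (fst z) (snd z))" "computable f"
  shows "computable (\<lambda>x. map (h x) (f x))"
  by (rule computable_list_recursion[OF assms(2) computable_Nil,
        where f = "\<lambda>x. map (h x)" and b = "\<lambda>x y ys r. h x y # r"])
    (intro computable_intros computable_comp2[OF assms(1)], auto)

lemma computable_concat [computable_intros]:
  assumes "computable f"
  shows "computable (\<lambda>x. concat (f x))"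
  by (rule computable_list_recursion[OF assms computable_Nil, where f = "\<lambda>x. concat" and b = "\<lambda>x y ys r. y @ r"])
    (intro computable_intros, auto)

lemma computable_filter [computable_intros]:
  assumes "computable (\<lambda>z. h (fst z) (snd z))" "computable f"
  shows "computable (\<lambda>x. filter (h x) (f x))"
  by (rule computable_list_recursion[OF assms(2) computable_Nil,
        where f = "\<lambda>x. filter (h x)" and b = "\<lambda>x y ys r. if h x y then y # r else r"])
    (intro computable_intros computable_comp2[OF assms(1)], auto)

lemma computable_length [computable_intros]:
  assumes "computable f"
  shows "computable (\<lambda>x. length (f x))"
  by (rule computable_list_recursion[OF assms computable_zero_nat, where f = "\<lambda>x. length" and b = "\<lambda>x y ys r. Suc r"])
    (intro computable_intros, auto)

lemma computable_rev [computable_intros]: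
  assumes "computable f"
  shows "computable (\<lambda>x. rev (f x))"
  by (rule computable_list_recursion[OF assms computable_Nil, where f = "\<lambda>x. rev" and b = "\<lambda>x y ys r. r @ [y]"])
    (intro computable_intros, auto)

lemma computable_list_ex [computable_intros]:
  assumes "computable (\<lambda>z. h (fst z) (snd z))" "computable f"
  shows "computable (\<lambda>x. list_ex (h x) (f x))"
  by (rule computable_list_recursion[OF assms(2) computable_False,
        where f = "\<lambda>x. list_ex (h x)" and b = "\<lambda>x y ys r. if h x y then True else r"])
    (intro computable_intros computable_comp2[OF assms(1)], auto)

lemma computable_list_all [computable_intros]:
  assumes "computable (\<lambda>z. h (fst z) (snd z))" "computable f"
  shows "computable (\<lambda>x. list_all (h x) (f x))"
  by (rule computable_list_recursion[OF assms(2) computable_True,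
        where f = "\<lambda>x. list_all (h x)" and b = "\<lambda>x y ys r. if h x y then r else False"])
    (intro computable_intros computable_comp2[OF assms(1)], auto)

lemma computable_nat_recursion:
  assumes "computable n" "computable a" "computable (\<lambda>z. b (fst z) (fst (snd z)) (snd (snd z)))"
    and "\<And>x. f x 0 = a x" "\<And>x k. f x (Suc k) = b x k (f x k)"
  shows "computable (\<lambda>x. f x (n x))"
proof -
  let ?f = "\<lambda>z. f (fst z) (snd z)"
  let ?d = "\<lambda>z. case snd z of 0 \<Rightarrow> [] | Suc k \<Rightarrow> [(fst z, k)]"
  let ?c = "\<lambda>w. case snd (fst w) of 0 \<Rightarrow> a (fst (fst w))
    | Suc k \<Rightarrow> (case snd w of [] \<Rightarrow> a (fst (fst w)) | r # rs \<Rightarrow> b (fst (fst w)) k r)"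
  have "computable ?f"
  proof (rule computable_rec[where d = ?d and c = ?c])
    show "computable ?d" by (intro computable_intros)
    show "computable ?c"
      by (intro computable_intros computable_comp[OF assms(2)] computable_comp3[OF assms(3)])
    show "wf (measure snd)" by simp
    show "(y, x) \<in> measure snd" if "y \<in> set (?d x)" for x y
      using that by (auto split: nat.splits)
    show "?f x = ?c (x, map ?f (?d x))" for x
      by (cases "snd x") (simp_all add: assms)
  qed
  from computable_comp2[OF this computable_id assms(1)] show ?thesis .
qed

lemma computable_upt [computable_intros]:
  assumes "computable f" "computable g"
  shows "computable (\<lambda>x. [f x..<g x])"
  by (rule computable_nat_recursion[OF assms(2) computable_Nil, where f = "\<lambda>x k. [f x..<k]"
        and b = "\<lambda>x k r. if k < f x then [] else r @ [k]"])
    (intro computable_intros computable_comp[OF assms(1)], auto)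

lemma computable_funpow:
  fixes h :: "'a::encodable \<Rightarrow> 'b::encodable \<Rightarrow> 'b"
  assumes "computable (\<lambda>z. h (fst z) (snd z))" "computable n" "computable f"
  shows "computable (\<lambda>x. (h x ^^ n x) (f x))"
  by (rule computable_nat_recursion[OF assms(2) assms(3), where f = "\<lambda>x k. (h x ^^ k) (f x)"
        and b = "\<lambda>x k r. h x r"])
    (intro computable_intros computable_comp2[OF assms(1)], auto)

lemma computable_replicate [computable_intros]:
  assumes "computable n" "computable f"
  shows "computable (\<lambda>x. replicate (n x) (f x))"
  by (rule computable_nat_recursion[OF assms(1) computable_Nil, where f = "\<lambda>x k. replicate k (f x)"
        and b = "\<lambda>x k r. f x # r"])
    (intro computable_intros computable_comp[OF assms(2)], auto)

lemma computable_eq_obj: "computable (\<lambda>z. fst z = (snd z :: obj))"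
proof -
  let ?d = "\<lambda>z. case fst z of Num r \<Rightarrow> [] | Empty \<Rightarrow> []
    | Cell a b \<Rightarrow> (case snd z of Num r \<Rightarrow> [] | Empty \<Rightarrow> [] | Cell c d \<Rightarrow> [(a, c), (b, d)])"
  let ?c = "\<lambda>w :: (obj \<times> obj) \<times> bool list.
    case fst (fst w) of Num r \<Rightarrow> (case snd (fst w) of Num s \<Rightarrow> r = s | Empty \<Rightarrow> False | Cell c d \<Rightarrow> False)
    | Empty \<Rightarrow> (case snd (fst w) of Num s \<Rightarrow> False | Empty \<Rightarrow> True | Cell c d \<Rightarrow> False)
    | Cell a b \<Rightarrow> (case snd (fst w) of Num s \<Rightarrow> False | Empty \<Rightarrow> False | Cell c d \<Rightarrow> list_all (\<lambda>b. b) (snd w))"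
  show ?thesis
  proof (rule computable_rec[where d = ?d and c = ?c])
    show "computable ?d" by (intro computable_intros)
    show "computable ?c" by (intro computable_intros computable_eq_real)
    show "wf (measure (\<lambda>z :: obj \<times> obj. size (fst z)))" by simp
    show "(y, x) \<in> measure (\<lambda>z. size (fst z))" if "y \<in> set (?d x)" for x y
      using that by (cases "fst x"; cases "snd x") auto
    show "(fst x = snd x) = ?c (x, map (\<lambda>z. fst z = snd z) (?d x))" for x
      by (auto split: obj.splits)
  qed
qed

text \<open>Injectivity of \<open>enc\<close> reduces equality in any encodable type to equality of
  trees.\<close>

lemma computable_eq [computable_intros]:
  fixes f g :: "'a::encodable \<Rightarrow> 'b::encodable"
  assumes "computable f" "computable g"
  shows "computable (\<lambda>x. f x = g x)"
proof -
  have "computable (\<lambda>x. enc (f x))" "computable (\<lambda>x. enc (g x))"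
    using assms by (auto elim: computable_transfer)
  from computable_comp2[OF computable_eq_obj this] show ?thesis by simp
qed

text \<open>Absent keys are mapped to \<open>0\<close>, which is the right sign for the empty coefficient list.\<close>

definition lookup :: "('a \<times> real) list \<Rightarrow> 'a \<Rightarrow> real" where
  "lookup xs k = (case filter (\<lambda>p. fst p = k) xs of [] \<Rightarrow> 0 | p # _ \<Rightarrow> snd p)"

lemma computable_lookup [computable_intros]:
  assumes "computable f" "computable g"
  shows "computable (\<lambda>x. lookup (f x) (g x))"
  unfolding lookup_def by (intro computable_intros computable_comp[OF assms(1)] computable_comp[OF assms(2)])

lemma computable_drop [computable_intros]:
  assumes "computable f" "computable g"
  shows "computable (\<lambda>x. drop (g x) (f x))"
  by (rule computable_nat_recursion[OF assms(2) assms(1), where f = "\<lambda>x k. drop k (f x)"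
        and b = "\<lambda>x k r. case r of [] \<Rightarrow> [] | y # ys \<Rightarrow> ys"])
    (intro computable_intros, auto simp: drop_Suc tl_drop[symmetric] split: list.splits)

lemma computable_nth_default [computable_intros]:
  assumes "computable a" "computable f" "computable g"
  shows "computable (\<lambda>x. nth_default (a x) (f x) (g x))"
proof -
  have "nth_default a xs k = (case drop k xs of [] \<Rightarrow> a | y # _ \<Rightarrow> y)" for a :: 'b and xs k
    by (auto simp: nth_default_def Cons_nth_drop_Suc[symmetric])
  then show ?thesis
    by simp (intro computable_intros assms computable_comp[OF assms(1)])
qed

section \<open>Polynomials\<close>

text \<open>
  An object stands for a polynomial in Horner form: \<open>Cell a p\<close> is \<open>a + x * p\<close>, where \<open>x\<close> is the
  first variable and the polynomial \<open>a\<close> is in the remaining variables.  Numbers are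
  allowed as constants at every level, which makes the ring operations total and level-free.
\<close>

fun val :: "real list \<Rightarrow> obj \<Rightarrow> real" where
  "val \<rho> (Num r) = r"
| "val \<rho> Empty = 0"
| "val [] (Cell a p) = val [] a"
| "val (x # \<rho>) (Cell a p) = val \<rho> a + x * val (x # \<rho>) p"

fun padd :: "obj \<Rightarrow> obj \<Rightarrow> obj" where
  "padd Empty q = q"
| "padd p Empty = p"
| "padd (Num r) (Num s) = Num (r + s)"
| "padd (Num r) (Cell b q) = Cell (padd (Num r) b) q"
| "padd (Cell a p) (Num s) = Cell (padd a (Num s)) p"
| "padd (Cell a p) (Cell b q) = Cell (padd a b) (padd p q)"

text \<open>The last equation is (a + x p) (b + x q) = a b + x (a q + p (b + x q));
  \<open>Cell a Empty\<close> is the coefficient \<open>a\<close> regarded as a polynomial in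
  x.\<close>

fun pmul :: "obj \<Rightarrow> obj \<Rightarrow> obj" where
  "pmul Empty q = Empty"
| "pmul p Empty = Empty"
| "pmul (Num r) (Num s) = Num (r * s)"
| "pmul (Num r) (Cell b q) = Cell (pmul (Num r) b) (pmul (Num r) q)"
| "pmul (Cell a p) (Num s) = Cell (pmul a (Num s)) (pmul p (Num s))"
| "pmul (Cell a p) (Cell b q) = Cell (pmul a b) (padd (pmul (Cell a Empty) q) (pmul p (Cell b q)))"

text \<open>When the environment is exhausted, \<open>val []\<close> keeps only the constant
  coefficient, as if the missing variables were 0. Hence the homomorphism laws need no bound on the
  number of variables.\<close>

lemma val_padd [simp]: "val \<rho> (padd p q) = val \<rho> p + val \<rho> q"
proof (induction p q arbitrary: \<rho> rule: padd.induct)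
  case (4 r b q) then show ?case by (cases \<rho>) auto
next
  case (5 a p s) then show ?case by (cases \<rho>) auto
next
  case (6 a p b q) then show ?case by (cases \<rho>) (auto simp: algebra_simps)
qed auto

lemma val_pmul [simp]: "val \<rho> (pmul p q) = val \<rho> p * val \<rho> q"
proof (induction p q arbitrary: \<rho> rule: pmul.induct)
  case (4 r b q) then show ?case by (cases \<rho>) (auto simp: algebra_simps)
next
  case (5 a p s) then show ?case by (cases \<rho>) (auto simp: algebra_simps)
next
  case (6 a p b q) then show ?case by (cases \<rho>) (auto simp: algebra_simps)
qed auto

lemma computable_padd [computable_intros]:
  assumes "computable f" "computable g"
  shows "computable (\<lambda>x. padd (f x) (g x))"
proof -
  let ?d = "\<lambda>z. case fst z of Num r \<Rightarrow> (case snd z of Num s \<Rightarrow> [] | Empty \<Rightarrow> [] | Cell b q \<Rightarrow> [(Num r, b)])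
    | Empty \<Rightarrow> []
    | Cell a p \<Rightarrow> (case snd z of Num s \<Rightarrow> [(a, Num s)] | Empty \<Rightarrow> [] | Cell b q \<Rightarrow> [(a, b), (p, q)])"
  let ?c = "\<lambda>w. case fst (fst w) of
      Num r \<Rightarrow> (case snd (fst w) of Num s \<Rightarrow> Num (r + s) | Empty \<Rightarrow> Num r
        | Cell b q \<Rightarrow> (case snd w of [] \<Rightarrow> Empty | u # us \<Rightarrow> Cell u q))
    | Empty \<Rightarrow> snd (fst w)
    | Cell a p \<Rightarrow> (case snd (fst w) of
          Num s \<Rightarrow> (case snd w of [] \<Rightarrow> Empty | u # us \<Rightarrow> Cell u p)
        | Empty \<Rightarrow> Cell a p
        | Cell b q \<Rightarrow> (case snd w of [] \<Rightarrow> Empty | u # us \<Rightarrow> (case us of [] \<Rightarrow> Empty | v # vs \<Rightarrow> Cell u v)))"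
  have "computable (\<lambda>z. padd (fst z) (snd z))"
  proof (rule computable_rec[where d = ?d and c = ?c])
    show "computable ?d" by (intro computable_intros)
    show "computable ?c" by (intro computable_intros)
    show "wf (measure (\<lambda>z. size (fst z) + size (snd z)))" by simp
    show "(y, x) \<in> measure (\<lambda>z. size (fst z) + size (snd z))" if "y \<in> set (?d x)" for x y
      using that by (cases "fst x"; cases "snd x") auto
    show "padd (fst x) (snd x) = ?c (x, map (\<lambda>z. padd (fst z) (snd z)) (?d x))" for x
      by (cases "fst x"; cases "snd x") simp_all
  qed
  from computable_comp2[OF this assms] show ?thesis .
qed

lemma computable_pmul [computable_intros]:
  assumes "computable f" "computable g"
  shows "computable (\<lambda>x. pmul (f x) (g x))"
proof -
  let ?d = "\<lambda>z. case fst z of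
      Num r \<Rightarrow> (case snd z of Num s \<Rightarrow> [] | Empty \<Rightarrow> [] | Cell b q \<Rightarrow> [(Num r, b), (Num r, q)])
    | Empty \<Rightarrow> []
    | Cell a p \<Rightarrow> (case snd z of Num s \<Rightarrow> [(a, Num s), (p, Num s)] | Empty \<Rightarrow> []
        | Cell b q \<Rightarrow> [(a, b), (Cell a Empty, q), (p, Cell b q)])"
  let ?two = "\<lambda>us. case us of [] \<Rightarrow> Empty | u # us \<Rightarrow> (case us of [] \<Rightarrow> Empty | v # vs \<Rightarrow> Cell u v)"
  let ?c = "\<lambda>w. case fst (fst w) of
      Num r \<Rightarrow> (case snd (fst w) of Num s \<Rightarrow> Num (r * s) | Empty \<Rightarrow> Empty | Cell b q \<Rightarrow> ?two (snd w))
    | Empty \<Rightarrow> Empty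
    | Cell a p \<Rightarrow> (case snd (fst w) of Num s \<Rightarrow> ?two (snd w) | Empty \<Rightarrow> Empty
        | Cell b q \<Rightarrow> (case snd w of [] \<Rightarrow> Empty | u # us \<Rightarrow> (case us of [] \<Rightarrow> Empty
            | v # vs \<Rightarrow> (case vs of [] \<Rightarrow> Empty | t # ts \<Rightarrow> Cell u (padd v t)))))"
  have "computable (\<lambda>z. pmul (fst z) (snd z))"
  proof (rule computable_rec[where d = ?d and c = ?c])
    show "computable ?d" by (intro computable_intros)
    show "computable ?c" by (intro computable_intros)
    show "wf (measure (\<lambda>z. size (fst z) + size (snd z)))" by simp
    show "(y, x) \<in> measure (\<lambda>z. size (fst z) + size (snd z))" if "y \<in> set (?d x)" for x y
      using that by (cases "fst x"; cases "snd x") auto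
    show "pmul (fst x) (snd x) = ?c (x, map (\<lambda>z. pmul (fst z) (snd z)) (?d x))" for x
      by (cases "fst x"; cases "snd x") simp_all
  qed
  from computable_comp2[OF this assms] show ?thesis .
qed

definition pneg :: "obj \<Rightarrow> obj" where "pneg p = pmul (Num (-1)) p"

lemma val_pneg [simp]: "val \<rho> (pneg p) = - val \<rho> p"
  by (simp add: pneg_def)

lemma computable_pneg [computable_intros]: "computable f \<Longrightarrow> computable (\<lambda>x. pneg (f x))"
  unfolding pneg_def by (intro computable_intros)

definition psum :: "obj list \<Rightarrow> obj" where "psum ps = foldr padd ps Empty"

lemma val_psum [simp]: "val \<rho> (psum ps) = (\<Sum>p\<leftarrow>ps. val \<rho> p)"
  unfolding psum_def by (induction ps) auto

lemma computable_psum [computable_intros]: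
  assumes "computable f"
  shows "computable (\<lambda>x. psum (f x))"
  by (rule computable_list_recursion[OF assms computable_Empty, where f = "\<lambda>x. psum" and b = "\<lambda>x y ys r. padd y r"])
    (intro computable_intros, auto simp: psum_def)

fun pvar :: "nat \<Rightarrow> obj" where
  "pvar 0 = Cell Empty (Num 1)"
| "pvar (Suc i) = Cell (pvar i) Empty"

lemma val_pvar: "i < length \<rho> \<Longrightarrow> val \<rho> (pvar i) = \<rho> ! i"
proof (induction i arbitrary: \<rho>)
  case 0 then show ?case by (cases \<rho>) auto
next
  case (Suc i) then show ?case by (cases \<rho>) auto
qed

lemma computable_pvar [computable_intros]:
  assumes "computable f"
  shows "computable (\<lambda>x. pvar (f x))"
  by (rule computable_nat_recursion[OF assms, where f = "\<lambda>x. pvar" and a = "\<lambda>x. Cell Empty (Num 1)"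
        and b = "\<lambda>x y r. Cell r Empty"]) (intro computable_intros, intro computable_intros, auto)

lemma computable_val_Nil [computable_intros]:
  assumes "computable f"
  shows "computable (\<lambda>x. val [] (f x))"
proof -
  let ?d = "\<lambda>p. case p of Num r \<Rightarrow> [] | Empty \<Rightarrow> [] | Cell a q \<Rightarrow> [a]"
  let ?c = "\<lambda>w. case fst w of Num r \<Rightarrow> r | Empty \<Rightarrow> 0
    | Cell a q \<Rightarrow> (case snd w of [] \<Rightarrow> 0 | u # us \<Rightarrow> u)"
  have "computable (val [])"
  proof (rule computable_rec[where d = ?d and c = ?c])
    show "computable ?d" by (intro computable_intros)
    show "computable ?c" by (intro computable_intros)
    show "wf (measure (size :: obj \<Rightarrow> nat))" by simp
    show "(y, x) \<in> measure size" if "y \<in> set (?d x)" for x y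
      using that by (cases x) auto
    show "val [] x = ?c (x, map (val []) (?d x))" for x
      by (cases x) auto
  qed
  from computable_comp[OF this assms] show ?thesis .
qed

section \<open>Univariate polynomials with parameters\<close>

text \<open>
  Lists of coefficients begin with the leading one, and their length determines the formal degree:
  leading coefficients may vanish.
\<close>

fun rpoly :: "real list \<Rightarrow> real poly" where
  "rpoly [] = 0"
| "rpoly (a # p) = monom a (length p) + rpoly p"

lemma degree_rpoly_less: "p \<noteq> [] \<Longrightarrow> degree (rpoly p) < length p"
proof (induction p)
  case (Cons a p)
  show ?case
  proof (cases p)
    case Nil
    then show ?thesis by (simp add: monom_0)
  next
    case (Cons b q)
    with Cons.IH have "degree (rpoly p) < length p" by simp
    then have "degree (monom a (length p) + rpoly p) \<le> length p"
      by (intro degree_add_le) (auto simp: degree_monom_le)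
    then show ?thesis by simp
  qed
qed simp

lemma rpoly_lead:
  assumes "a \<noteq> 0"
  shows "degree (rpoly (a # p)) = length p" "lead_coeff (rpoly (a # p)) = a" "rpoly (a # p) \<noteq> 0"
proof -
  show *: "degree (rpoly (a # p)) = length p"
  proof (cases "p = []")
    case False
    then show ?thesis
      using assms degree_rpoly_less[of p] by (simp add: degree_add_eq_left degree_monom_eq)
  qed (simp add: monom_0)
  have "coeff (rpoly p) (length p) = 0"
    using degree_rpoly_less[of p] by (cases "p = []") (auto intro: coeff_eq_0)
  then show "lead_coeff (rpoly (a # p)) = a" unfolding * by simp
  then show "rpoly (a # p) \<noteq> 0" using assms by (metis leading_coeff_0_iff)
qed

definition kpoly :: "real list \<Rightarrow> obj list \<Rightarrow> real poly" where
  "kpoly \<rho> p = rpoly (map (val \<rho>) p)"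

lemma kpoly_Nil [simp]: "kpoly \<rho> [] = 0"
  and kpoly_Cons [simp]: "kpoly \<rho> (a # p) = monom (val \<rho> a) (length p) + kpoly \<rho> p"
  by (simp_all add: kpoly_def)

text \<open>Only the constant term is dropped and nothing is normalised, so the formal length of a
  nonempty list falls by exactly one, on which the closure of the keys relies.\<close>

fun kderiv :: "obj list \<Rightarrow> obj list" where
  "kderiv [] = []"
| "kderiv (a # p) = (if p = [] then [] else pmul (Num (real (length p))) a # kderiv p)"

lemma length_kderiv [simp]: "length (kderiv p) = length p - 1"
  by (induction p) auto

lemma kpoly_kderiv: "kpoly \<rho> (kderiv p) = pderiv (kpoly \<rho> p)"
  by (induction p) (auto simp: pderiv_add pderiv_monom monom_0 pderiv_pCons)

lemma computable_kderiv [computable_intros]: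
  assumes "computable f"
  shows "computable (\<lambda>x. kderiv (f x))"
  by (rule computable_list_recursion[OF assms computable_Nil, where f = "\<lambda>x. kderiv"
        and b = "\<lambda>x y ys r. if ys = [] then [] else pmul (Num (real (length ys))) y # r"])
    (intro computable_intros, auto)

lemma computable_zip [computable_intros]:
  assumes "computable f" "computable g"
  shows "computable (\<lambda>x. zip (f x) (g x))"
proof -
  let ?d = "\<lambda>z. case fst z of [] \<Rightarrow> [] | x # xs \<Rightarrow> (case snd z of [] \<Rightarrow> [] | y # ys \<Rightarrow> [(xs, ys)])"
  let ?c = "\<lambda>w. case fst (fst w) of [] \<Rightarrow> [] | x # xs \<Rightarrow> (case snd (fst w) of [] \<Rightarrow> []
    | y # ys \<Rightarrow> (case snd w of [] \<Rightarrow> [] | u # us \<Rightarrow> (x, y) # u))"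
  have "computable (\<lambda>z. zip (fst z) (snd z))"
  proof (rule computable_rec[where d = ?d and c = ?c])
    show "computable ?d" by (intro computable_intros)
    show "computable ?c" by (intro computable_intros)
    show "wf (measure (\<lambda>z. length (fst z)))" by simp
    show "(y, x) \<in> measure (\<lambda>z. length (fst z))" if "y \<in> set (?d x)" for x y
      using that by (cases "fst x"; cases "snd x") auto
    show "zip (fst x) (snd x) = ?c (x, map (\<lambda>z. zip (fst z) (snd z)) (?d x))" for x
      by (cases "fst x"; cases "snd x") simp_all
  qed
  from computable_comp2[OF this assms] show ?thesis .
qed

text \<open>
  One step of pseudo-division replaces \<open>p\<close> by \<open>b\<^sup>2 p - a b x\<^sup>k q\<close>, where \<open>a\<close> and \<open>b\<close> are the leading
  coefficients.  The square keeps the sign of \<open>p\<close> at the roots of \<open>q\<close>.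
\<close>

definition prem_step :: "obj list \<Rightarrow> obj list \<Rightarrow> obj list" where
  "prem_step q p = (case q of [] \<Rightarrow> [] | b # q' \<Rightarrow> (case p of [] \<Rightarrow> [] | a # p' \<Rightarrow>
    map (\<lambda>(u, v). padd (pmul (pmul b b) u) (pneg (pmul (pmul a b) v)))
      (zip p' (q' @ replicate (length p' - length q') Empty))))"

text \<open>A step removes exactly one coefficient, so for nonempty \<open>q\<close> not longer than
  \<open>p\<close> the result has length \<open>length q - 1\<close>, whatever the length of
  \<open>p\<close>. For shorter \<open>p\<close> the count truncates to 0 and \<open>p\<close> is
  returned.\<close>

definition prem :: "obj list \<Rightarrow> obj list \<Rightarrow> obj list" where
  "prem p q = (prem_step q ^^ (Suc (length p) - length q)) p"

lemma computable_prem [computable_intros]: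
  assumes "computable f" "computable g"
  shows "computable (\<lambda>x. prem (f x) (g x))"
proof -
  have "computable (\<lambda>z. prem_step (snd (fst z)) (snd z))"
    unfolding prem_step_def by (intro computable_intros)
  then have "computable (\<lambda>z. prem (fst z) (snd z))"
    unfolding prem_def by (intro computable_funpow[where h = "\<lambda>x. prem_step (snd x)"] computable_intros)
  from computable_comp2[OF this assms] show ?thesis .
qed

lemma length_prem_step: "q \<noteq> [] \<Longrightarrow> length q \<le> length p \<Longrightarrow> length (prem_step q p) = length p - 1"
  by (auto simp: prem_step_def split: list.splits)

lemma length_prem_steps:
  "q \<noteq> [] \<Longrightarrow> k + length q \<le> Suc (length p) \<Longrightarrow> length ((prem_step q ^^ k) p) = length p - k"
  by (induction k) (auto simp: length_prem_step)

lemma length_prem: "q \<noteq> [] \<Longrightarrow> length q \<le> length p \<Longrightarrow> length (prem p q) = length q - 1"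
  unfolding prem_def by (subst length_prem_steps) auto

lemma kpoly_append_zeros: "kpoly \<rho> (p @ replicate k Empty) = kpoly \<rho> p * monom 1 k"
proof (induction p)
  case Nil
  show ?case by (induction k) auto
next
  case (Cons a p)
  then show ?case by (simp add: mult_monom algebra_simps)
qed

lemma kpoly_map_zip:
  "length p = length q \<Longrightarrow> kpoly \<rho> (map (\<lambda>(u, v). padd (pmul c u) (pneg (pmul d v))) (zip p q))
    = Polynomial.smult (val \<rho> c) (kpoly \<rho> p) - Polynomial.smult (val \<rho> d) (kpoly \<rho> q)"
  by (induction p q rule: list_induct2)
    (auto simp: algebra_simps smult_add_right smult_diff_right smult_monom diff_monom[symmetric])

text \<open>The leading terms cancel identically and are never stored, so the computation involves
  the tails; q(x) = 0 expresses the tail of \<open>q\<close> at \<open>x\<close> through its leading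
  term.\<close>

lemma poly_prem_step:
  assumes "length q \<le> length p" "q = b # q'" "poly (kpoly \<rho> q) x = 0"
  shows "poly (kpoly \<rho> (prem_step q p)) x = (val \<rho> b)\<^sup>2 * poly (kpoly \<rho> p) x"
proof -
  obtain a p' where p: "p = a # p'" and len: "length q' \<le> length p'"
    using assms by (cases p) auto
  let ?k = "length p' - length q'" and ?a = "val \<rho> a" and ?b = "val \<rho> b"
  have q: "poly (kpoly \<rho> q') x = - ?b * x ^ length q'"
    using assms(2,3) by (simp add: poly_monom eq_neg_iff_add_eq_0 add.commute)
  have "poly (kpoly \<rho> (prem_step q p)) x
      = ?b\<^sup>2 * poly (kpoly \<rho> p') x - ?a * ?b * (poly (kpoly \<rho> q') x * x ^ ?k)"
    using len unfolding assms(2) p prem_step_def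
    by (simp add: kpoly_map_zip kpoly_append_zeros poly_monom power2_eq_square)
  also have "poly (kpoly \<rho> q') x * x ^ ?k = - ?b * x ^ length p'"
    using len unfolding q by (simp add: power_add[symmetric])
  finally show ?thesis
    unfolding p by (simp add: poly_monom power2_eq_square algebra_simps)
qed

lemma sgn_poly_prem:
  assumes "q = b # q'" "val \<rho> b \<noteq> 0" "poly (kpoly \<rho> q) x = 0"
  shows "sgn (poly (kpoly \<rho> (prem p q)) x) = sgn (poly (kpoly \<rho> p) x)"
proof -
  have "sgn (poly (kpoly \<rho> ((prem_step q ^^ k) p)) x) = sgn (poly (kpoly \<rho> p) x)"
    if "k + length q \<le> Suc (length p)" for k
    using that
  proof (induction k)
    case (Suc k)
    then have "length q \<le> length ((prem_step q ^^ k) p)"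
      using assms(1) by (subst length_prem_steps) auto
    moreover have "(sgn (val \<rho> b))\<^sup>2 = 1" using assms(2) by (simp add: sgn_if)
    ultimately show ?case using poly_prem_step[OF _ assms(1,3)] Suc by (simp add: sgn_mult)
  qed simp
  then show ?thesis using assms(1) unfolding prem_def
    by (cases "length q \<le> Suc (length p)") auto
qed

section \<open>Sign tables\<close>

text \<open>A nonzero derivative has finitely many roots, so its constant sign on the interval is
  not 0. Stating the decreasing case for \<open>- f\<close> leaves a single kind of monotonicity to
  analyse.\<close>

lemma poly_const_sgn_cases:
  fixes f :: "real poly"
  assumes "f \<noteq> 0" "lo < hi" and "\<And>x y. lo < x \<Longrightarrow> x < hi \<Longrightarrow> lo < y \<Longrightarrow> y < hi \<Longrightarrow>
    sgn (poly (pderiv f) x) = sgn (poly (pderiv f) y)"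
  obtains c where "c \<noteq> 0" "f = [:c:]"
  | "\<And>x. lo < x \<Longrightarrow> x < hi \<Longrightarrow> 0 < poly (pderiv f) x"
  | "\<And>x. lo < x \<Longrightarrow> x < hi \<Longrightarrow> 0 < poly (pderiv (- f)) x"
proof (cases "pderiv f = 0")
  case True
  then obtain c where "f = [:c:]"
    using pderiv_eq_0_iff[of f] degree_eq_zeroE by blast
  with assms(1) that(1) show ?thesis by auto
next
  case False
  then have "finite {x. poly (pderiv f) x = 0}" by (rule poly_roots_finite)
  moreover have "infinite {lo<..<hi}" using assms(2) by simp
  ultimately obtain z where z: "lo < z" "z < hi" "poly (pderiv f) z \<noteq> 0"
    by (metis (mono_tags, lifting) finite_subset greaterThanLessThan_iff mem_Collect_eq subsetI)
  show ?thesis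
  proof (cases "0 < poly (pderiv f) z")
    case True
    then have "0 < poly (pderiv f) x" if "lo < x" "x < hi" for x
      using assms(3)[OF z(1,2) that] by (auto simp: sgn_if split: if_splits)
    then show ?thesis by (rule that(2))
  next
    case False
    then have "poly (pderiv f) x < 0" if "lo < x" "x < hi" for x
      using z(3) assms(3)[OF z(1,2) that] by (auto simp: sgn_if split: if_splits)
    then show ?thesis by (intro that(3)) (simp add: pderiv_minus)
  qed
qed

text \<open>The case split is that of \<open>extend\<close>. Strict monotonicity leaves for (s, t)
  only (-1, -1), (-1, 0), (-1, 1), (0, 1) and (1, 1), and only (-1, 1) has a root inside.\<close>

lemma sgn_increasing_poly:
  fixes f :: "real poly"
  assumes "lo < hi" and pos: "\<And>x. lo < x \<Longrightarrow> x < hi \<Longrightarrow> 0 < poly (pderiv f) x"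
    and s: "s = sgn (poly f lo)" and t: "t = sgn (poly f hi)"
  shows "if s * t = -1
    then \<exists>z. lo < z \<and> z < hi \<and> poly f z = 0 \<and> (\<forall>x. lo < x \<and> x < z \<longrightarrow> sgn (poly f x) = s)
      \<and> (\<forall>x. z < x \<and> x < hi \<longrightarrow> sgn (poly f x) = t)
    else \<forall>x. lo < x \<and> x < hi \<longrightarrow> sgn (poly f x) = (if s = 0 then t else s)"
proof -
  have mono: "poly f x < poly f y" if "lo \<le> x" "x < y" "y \<le> hi" for x y
  proof (rule DERIV_pos_imp_increasing_open[OF that(2)])
    fix u assume "x < u" "u < y"
    then show "\<exists>D. DERIV (poly f) u :> D \<and> D > 0"
      using that pos[of u] by (intro exI[of _ "poly (pderiv f) u"]) auto
  qed (intro continuous_intros)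
  show ?thesis
  proof (cases "s * t = -1")
    case True
    with mono[of lo hi] assms(1) have st: "s = -1" "t = 1" "poly f lo < 0" "0 < poly f hi"
      unfolding s t by (auto simp: sgn_if split: if_splits)
    then obtain z where z: "lo < z" "z < hi" "poly f z = 0"
      using poly_IVT_pos[OF assms(1) st(3,4)] by auto
    have "sgn (poly f x) = s" if "lo < x" "x < z" for x
      using mono[of x z] z that st by simp
    moreover have "sgn (poly f x) = t" if "z < x" "x < hi" for x
      using mono[of z x] z that st by simp
    ultimately show ?thesis using True z by auto
  next
    case False
    have "sgn (poly f x) = (if s = 0 then t else s)" if "lo < x" "x < hi" for x
      using False mono[of lo x] mono[of x hi] that unfolding s t by (auto simp: sgn_if split: if_splits)
    with False show ?thesis by auto
  qed
qed

lemma sgn_poly_between: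
  fixes f :: "real poly"
  assumes "f \<noteq> 0" "lo < hi" and "\<And>x y. lo < x \<Longrightarrow> x < hi \<Longrightarrow> lo < y \<Longrightarrow> y < hi \<Longrightarrow>
    sgn (poly (pderiv f) x) = sgn (poly (pderiv f) y)"
    and s: "s = sgn (poly f lo)" and t: "t = sgn (poly f hi)"
  shows "if s * t = -1
    then \<exists>z. lo < z \<and> z < hi \<and> poly f z = 0 \<and> (\<forall>x. lo < x \<and> x < z \<longrightarrow> sgn (poly f x) = s)
      \<and> (\<forall>x. z < x \<and> x < hi \<longrightarrow> sgn (poly f x) = t)
    else \<forall>x. lo < x \<and> x < hi \<longrightarrow> sgn (poly f x) = (if s = 0 then t else s)"
proof (rule poly_const_sgn_cases[OF assms(1-3)])
  fix c assume "c \<noteq> 0" "f = [:c:]"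
  then show ?thesis unfolding s t by (auto simp: sgn_if)
next
  assume "\<And>x. lo < x \<Longrightarrow> x < hi \<Longrightarrow> 0 < poly (pderiv f) x"
  then show ?thesis by (rule sgn_increasing_poly[OF assms(2) _ s t])
next
  assume 3: "\<And>x. lo < x \<Longrightarrow> x < hi \<Longrightarrow> 0 < poly (pderiv (- f)) x"
  have st: "- s = sgn (poly (- f) lo)" "- t = sgn (poly (- f) hi)"
    unfolding s t by (simp_all add: sgn_minus)
  have "sgn (poly (- f) x) = - sgn (poly f x)" for x by (simp add: sgn_minus)
  from sgn_increasing_poly[OF assms(2) 3 st, simplified this] show ?thesis
    by (cases "s = 0") (simp_all add: minus_equation_iff[of _ "- _"] split: if_splits)
qed

section \<open>Sign tables and the insertion of one polynomial\<close>

type_synonym row = "(obj list \<times> real) list"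
type_synonym table = "row \<times> (row \<times> row) list"

definition sign_row :: "real list \<Rightarrow> obj list list \<Rightarrow> real \<Rightarrow> row" where
  "sign_row \<rho> K x = map (\<lambda>p. (p, sgn (poly (kpoly \<rho> p) x))) K"

text \<open>The empty list yields the zero polynomial, so a nonvanishing leading coefficient implies
  nonemptiness.\<close>

definition lead :: "obj list \<Rightarrow> obj" where
  "lead p = (case p of [] \<Rightarrow> Empty | a # _ \<Rightarrow> a)"

text \<open>The leading coefficient must not vanish because pseudo-division by \<open>q\<close>
  preserves signs at \<open>z\<close> only then.\<close>

definition rooted :: "real list \<Rightarrow> obj list list \<Rightarrow> real \<Rightarrow> bool" where
  "rooted \<rho> K z \<longleftrightarrow> (\<exists>q\<in>set K. q \<noteq> [] \<and> val \<rho> (lead q) \<noteq> 0 \<and> poly (kpoly \<rho> q) z = 0)"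

text \<open>
  A table consists of the signs of the polynomials \<open>K\<close> on \<open>(lo, z\<^sub>1)\<close>, at \<open>z\<^sub>1\<close>, on \<open>(z\<^sub>1, z\<^sub>2)\<close>, \<dots>,
  where every \<open>z\<^sub>i\<close> is a root of some member of \<open>K\<close> with nonvanishing leading coefficient.
\<close>

fun table_ok :: "real list \<Rightarrow> obj list list \<Rightarrow> real \<Rightarrow> real \<Rightarrow> row \<Rightarrow> (row \<times> row) list \<Rightarrow> bool" where
  "table_ok \<rho> K lo hi r [] \<longleftrightarrow> lo < hi \<and> (\<forall>x. lo < x \<and> x < hi \<longrightarrow> sign_row \<rho> K x = r)"
| "table_ok \<rho> K lo hi r ((r1, r2) # T) \<longleftrightarrow> (\<exists>z. lo < z \<and> z < hi \<and> rooted \<rho> K z \<and>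
    (\<forall>x. lo < x \<and> x < z \<longrightarrow> sign_row \<rho> K x = r) \<and> sign_row \<rho> K z = r1 \<and> table_ok \<rho> K z hi r2 T)"

lemma table_ok_ConsI:
  assumes "lo < z" "z < hi" "rooted \<rho> K z" "\<And>x. lo < x \<Longrightarrow> x < z \<Longrightarrow> sign_row \<rho> K x = r"
    "sign_row \<rho> K z = r1" "table_ok \<rho> K z hi r2 T"
  shows "table_ok \<rho> K lo hi r ((r1, r2) # T)"
  using assms by auto

definition rows :: "table \<Rightarrow> row list" where
  "rows T = fst T # concat (map (\<lambda>(r1, r2). [r1, r2]) (snd T))"

lemma rows_Cons: "rows (r, (r1, r2) # T) = r # r1 # rows (r2, T)"
  by (simp add: rows_def)

lemma image_eq_singleton: "a \<in> A \<Longrightarrow> (\<And>x. x \<in> A \<Longrightarrow> f x = r) \<Longrightarrow> f ` A = {r}"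
  by (auto simp: image_iff intro!: bexI[of _ a])

lemma set_rows: "table_ok \<rho> K lo hi r T \<Longrightarrow> set (rows (r, T)) = sign_row \<rho> K ` {lo<..<hi}"
proof (induction T arbitrary: lo r)
  case Nil
  then have "(lo + hi) / 2 \<in> {lo<..<hi}" by auto
  moreover have "\<And>x. x \<in> {lo<..<hi} \<Longrightarrow> sign_row \<rho> K x = r" using Nil by auto
  ultimately have "sign_row \<rho> K ` {lo<..<hi} = {r}" by (rule image_eq_singleton)
  then show ?case by (simp add: rows_def)
next
  case (Cons rr T)
  obtain r1 r2 where rr: "rr = (r1, r2)" by fastforce
  from Cons.prems obtain z where z: "lo < z" "z < hi" "\<And>x. lo < x \<Longrightarrow> x < z \<Longrightarrow> sign_row \<rho> K x = r"
    "sign_row \<rho> K z = r1" "table_ok \<rho> K z hi r2 T" unfolding rr by auto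
  have "{lo<..<hi} = {lo<..<z} \<union> {z} \<union> {z<..<hi}" using z(1,2) by auto
  moreover have "sign_row \<rho> K ` {lo<..<z} = {r}"
  proof -
    have "(lo + z) / 2 \<in> {lo<..<z}" using z(1) by auto
    moreover have "\<And>x. x \<in> {lo<..<z} \<Longrightarrow> sign_row \<rho> K x = r" using z(3) by auto
    ultimately show ?thesis by (rule image_eq_singleton)
  qed
  ultimately show ?case
    using Cons.IH[OF z(5)] z(4) by (simp add: rr rows_Cons image_Un insert_commute)
qed

lemma lookup_map: "lookup (map (\<lambda>k. (k, f k)) K) k = (if k \<in> set K then f k else 0)"
  unfolding lookup_def by (induction K) auto

lemma lookup_sign_row: "p \<in> set K \<or> p = [] \<Longrightarrow> lookup (sign_row \<rho> K x) p = sgn (poly (kpoly \<rho> p) x)"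
  by (auto simp: sign_row_def lookup_map)

text \<open>A \<open>q\<close> that vanishes at the point is picked from the row, with leading
  coefficient nonzero according to \<Gamma>. The remainder by \<open>q\<close> has the sign of
  \<open>p\<close> there, and that sign is already in the row. For correct signs the default 0 is
  not reached at a \<open>rooted\<close> point.\<close>

definition point_sign :: "(obj \<times> real) list \<Rightarrow> obj list \<Rightarrow> row \<Rightarrow> real" where
  "point_sign \<Gamma> p r = (case filter (\<lambda>qs. snd qs = 0 \<and> fst qs \<noteq> [] \<and> lookup \<Gamma> (lead (fst qs)) \<noteq> 0) r of
     [] \<Rightarrow> 0 | qs # _ \<Rightarrow> lookup r (prem p (fst qs)))"

text \<open>
  The polynomial \<open>p\<close> is monotone between consecutive points, because the sign of its derivative is
  in the table.  Hence its signs \<open>s\<close> and \<open>t\<close> at the ends of an interval determine its signs inside,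
  and the only root that has to be inserted is the one between opposite signs.
\<close>

fun extend :: "(obj \<times> real) list \<Rightarrow> obj list \<Rightarrow> real \<Rightarrow> real \<Rightarrow> row \<Rightarrow> (row \<times> row) list \<Rightarrow> table" where
  "extend \<Gamma> p e s r [] = (if s * e = -1
     then ((p, s) # r, [((p, 0) # r, (p, e) # r)])
     else ((p, if s = 0 then e else s) # r, []))"
| "extend \<Gamma> p e s r ((r1, r2) # T) = (let t = point_sign \<Gamma> p r1; T' = extend \<Gamma> p e t r2 T;
     rest = ((p, t) # r1, fst T') # snd T' in
     if s * t = -1
     then ((p, s) # r, ((p, 0) # r, (p, t) # r) # rest)
     else ((p, if s = 0 then t else s) # r, rest))"

definition good_signs :: "real list \<Rightarrow> (obj \<times> real) list \<Rightarrow> obj list list \<Rightarrow> bool" where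
  "good_signs \<rho> \<Gamma> K \<longleftrightarrow> (\<forall>p\<in>set K. lookup \<Gamma> (lead p) = sgn (val \<rho> (lead p)))"

lemma point_sign:
  assumes "rooted \<rho> K z" "good_signs \<rho> \<Gamma> K"
    and closed: "\<And>q. q \<in> set K \<Longrightarrow> q \<noteq> [] \<Longrightarrow> prem p q \<in> set K \<or> prem p q = []"
  shows "point_sign \<Gamma> p (sign_row \<rho> K z) = sgn (poly (kpoly \<rho> p) z)"
proof -
  let ?Q = "\<lambda>qs. snd qs = 0 \<and> fst qs \<noteq> [] \<and> lookup \<Gamma> (lead (fst qs)) \<noteq> 0"
  obtain q where "q \<in> set K" "q \<noteq> []" "val \<rho> (lead q) \<noteq> 0" "poly (kpoly \<rho> q) z = 0"
    using assms(1) by (auto simp: rooted_def)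
  then have "(q, 0) \<in> set (filter ?Q (sign_row \<rho> K z))"
    using assms(2) by (auto simp: sign_row_def good_signs_def sgn_zero_iff)
  then obtain qs rest where f: "filter ?Q (sign_row \<rho> K z) = qs # rest"
    by (cases "filter ?Q (sign_row \<rho> K z)") auto
  then have "qs \<in> set (filter ?Q (sign_row \<rho> K z))" by simp
  then have q': "fst qs \<in> set K" "fst qs \<noteq> []" "val \<rho> (lead (fst qs)) \<noteq> 0"
      "poly (kpoly \<rho> (fst qs)) z = 0"
    using assms(2) by (auto simp: sign_row_def good_signs_def sgn_zero_iff)
  obtain b q'' where "fst qs = b # q''" using q'(2) by (meson list.exhaust)
  moreover from this have "val \<rho> b \<noteq> 0" using q'(3) by (simp add: lead_def)
  ultimately have "sgn (poly (kpoly \<rho> (prem p (fst qs))) z) = sgn (poly (kpoly \<rho> p) z)"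
    using q'(4) by (intro sgn_poly_prem)
  then show ?thesis
    using f lookup_sign_row[OF closed[OF q'(1,2)]] by (simp add: point_sign_def)
qed

lemma sign_row_Cons: "sign_row \<rho> (p # K) x = (p, sgn (poly (kpoly \<rho> p) x)) # sign_row \<rho> K x"
  by (simp add: sign_row_def)

lemma rooted_Cons: "rooted \<rho> K z \<Longrightarrow> rooted \<rho> (p # K) z"
  by (auto simp: rooted_def)

lemma kpoly_nonzero: "val \<rho> (lead p) \<noteq> 0 \<Longrightarrow> kpoly \<rho> p \<noteq> 0 \<and> p \<noteq> []"
  by (cases p) (auto simp: lead_def kpoly_def simp del: rpoly.simps dest: rpoly_lead(3))

text \<open>The sign at the right end of an interval serves as \<open>s\<close> for the next one.
  Inside an interval the row is constant, hence so is the sign of the derivative, as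
  \<open>sgn_poly_between\<close> demands. An inserted root is \<open>rooted\<close> through
  \<open>p\<close> itself.\<close>

lemma extend_ok:
  assumes lead: "val \<rho> (lead p) \<noteq> 0" and good: "good_signs \<rho> \<Gamma> K"
    and deriv: "kderiv p \<in> set K \<or> kderiv p = []"
    and closed: "\<And>q. q \<in> set K \<Longrightarrow> q \<noteq> [] \<Longrightarrow> prem p q \<in> set K \<or> prem p q = []"
    and e: "e = sgn (poly (kpoly \<rho> p) hi)"
  shows "table_ok \<rho> K lo hi r T \<Longrightarrow> s = sgn (poly (kpoly \<rho> p) lo) \<Longrightarrow>
    table_ok \<rho> (p # K) lo hi (fst (extend \<Gamma> p e s r T)) (snd (extend \<Gamma> p e s r T))"
proof (induction T arbitrary: lo r s)
  note nz = kpoly_nonzero[OF lead, THEN conjunct1]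
  have der: "sgn (poly (pderiv (kpoly \<rho> p)) x) = sgn (poly (pderiv (kpoly \<rho> p)) y)"
    if "sign_row \<rho> K x = r" "sign_row \<rho> K y = r" for x y r
    using that lookup_sign_row[OF deriv] by (metis kpoly_kderiv)
  have rooted: "rooted \<rho> (p # K) z" if "poly (kpoly \<rho> p) z = 0" for z
    using that lead kpoly_nonzero[OF lead] by (auto simp: rooted_def)
  {
    case Nil
    then have lohi: "lo < hi" and r: "\<And>x. lo < x \<Longrightarrow> x < hi \<Longrightarrow> sign_row \<rho> K x = r" by auto
    have seg: "if s * e = -1
      then \<exists>z. lo < z \<and> z < hi \<and> poly (kpoly \<rho> p) z = 0 \<and> (\<forall>x. lo < x \<and> x < z \<longrightarrow> sgn (poly (kpoly \<rho> p) x) = s)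
        \<and> (\<forall>x. z < x \<and> x < hi \<longrightarrow> sgn (poly (kpoly \<rho> p) x) = e)
      else \<forall>x. lo < x \<and> x < hi \<longrightarrow> sgn (poly (kpoly \<rho> p) x) = (if s = 0 then e else s)"
      by (rule sgn_poly_between[OF nz lohi _ Nil(2) e]) (rule der; rule r; assumption)
    show ?case
    proof (cases "s * e = -1")
      case True
      with seg obtain z where "lo < z" "z < hi" "poly (kpoly \<rho> p) z = 0"
        "\<And>x. lo < x \<Longrightarrow> x < z \<Longrightarrow> sgn (poly (kpoly \<rho> p) x) = s"
        "\<And>x. z < x \<Longrightarrow> x < hi \<Longrightarrow> sgn (poly (kpoly \<rho> p) x) = e" by auto
      then have "table_ok \<rho> (p # K) lo hi ((p, s) # r) [((p, 0) # r, (p, e) # r)]"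
        using r rooted by - (rule table_ok_ConsI[of _ z], simp_all add: sign_row_Cons)
      with True show ?thesis by simp
    next
      case False
      with seg lohi r show ?thesis by (auto simp: sign_row_Cons)
    qed
  next
    case (Cons rr T)
    obtain r1 r2 where rr: "rr = (r1, r2)" by fastforce
    from Cons.prems obtain y where y: "lo < y" "y < hi" "rooted \<rho> K y"
      and r: "\<And>x. lo < x \<Longrightarrow> x < y \<Longrightarrow> sign_row \<rho> K x = r"
      and r1: "sign_row \<rho> K y = r1" and T: "table_ok \<rho> K y hi r2 T" unfolding rr by auto
    define t where "t = point_sign \<Gamma> p r1"
    have t: "t = sgn (poly (kpoly \<rho> p) y)"
      unfolding t_def r1[symmetric] by (rule point_sign[OF y(3) good closed])
    define T' where "T' = extend \<Gamma> p e t r2 T"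
    have T': "table_ok \<rho> (p # K) y hi (fst T') (snd T')"
      unfolding T'_def by (rule Cons.IH[OF T t])
    have seg: "if s * t = -1
      then \<exists>z. lo < z \<and> z < y \<and> poly (kpoly \<rho> p) z = 0 \<and> (\<forall>x. lo < x \<and> x < z \<longrightarrow> sgn (poly (kpoly \<rho> p) x) = s)
        \<and> (\<forall>x. z < x \<and> x < y \<longrightarrow> sgn (poly (kpoly \<rho> p) x) = t)
      else \<forall>x. lo < x \<and> x < y \<longrightarrow> sgn (poly (kpoly \<rho> p) x) = (if s = 0 then t else s)"
      by (rule sgn_poly_between[OF nz y(1) _ Cons.prems(2) t]) (rule der; rule r; assumption)
    have ext: "extend \<Gamma> p e s r (rr # T) = (if s * t = -1
       then ((p, s) # r, ((p, 0) # r, (p, t) # r) # ((p, t) # r1, fst T') # snd T')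
       else ((p, if s = 0 then t else s) # r, ((p, t) # r1, fst T') # snd T'))"
      unfolding rr by (simp add: t_def T'_def Let_def)
    show ?case
    proof (cases "s * t = -1")
      case True
      with seg obtain z where z: "lo < z" "z < y" "poly (kpoly \<rho> p) z = 0"
        "\<And>x. lo < x \<Longrightarrow> x < z \<Longrightarrow> sgn (poly (kpoly \<rho> p) x) = s"
        "\<And>x. z < x \<Longrightarrow> x < y \<Longrightarrow> sgn (poly (kpoly \<rho> p) x) = t" by auto
      have "table_ok \<rho> (p # K) z hi ((p, t) # r) (((p, t) # r1, fst T') # snd T')"
        using z y r r1 t T' by - (rule table_ok_ConsI[of _ y], simp_all add: sign_row_Cons rooted_Cons)
      then have "table_ok \<rho> (p # K) lo hi ((p, s) # r) (((p, 0) # r, (p, t) # r) # ((p, t) # r1, fst T') # snd T')"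
        using z y r rooted by - (rule table_ok_ConsI[of _ z], simp_all add: sign_row_Cons)
      with True show ?thesis unfolding ext by simp
    next
      case False
      then have "table_ok \<rho> (p # K) lo hi ((p, if s = 0 then t else s) # r) (((p, t) # r1, fst T') # snd T')"
        using seg y r r1 t T' by - (rule table_ok_ConsI[of _ y], simp_all add: sign_row_Cons rooted_Cons)
      with False show ?thesis unfolding ext by simp
    qed
  }
qed

text \<open>If the leading coefficient vanishes, \<open>p\<close> agrees with its tail, whose signs
  are already known. Otherwise the signs at the two ends are those at plus and minus infinity, the
  degree being \<open>length p - 1\<close>.\<close>

definition add_key :: "(obj \<times> real) list \<Rightarrow> obj list \<Rightarrow> table \<Rightarrow> table" where
  "add_key \<Gamma> p T = (if lookup \<Gamma> (lead p) = 0
     then ((p, lookup (fst T) (drop 1 p)) # fst T,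
       map (\<lambda>rr. ((p, lookup (fst rr) (drop 1 p)) # fst rr, (p, lookup (snd rr) (drop 1 p)) # snd rr)) (snd T))
     else extend \<Gamma> p (lookup \<Gamma> (lead p)) (lookup \<Gamma> (lead p) * (-1) ^ (length p - 1)) (fst T) (snd T))"

fun sign_table :: "(obj \<times> real) list \<Rightarrow> obj list list \<Rightarrow> table" where
  "sign_table \<Gamma> [] = ([], [])"
| "sign_table \<Gamma> (p # K) = add_key \<Gamma> p (sign_table \<Gamma> K)"

lemma kpoly_drop_lead: "val \<rho> (lead p) = 0 \<Longrightarrow> kpoly \<rho> (drop 1 p) = kpoly \<rho> p"
  by (cases p) (auto simp: lead_def)

lemma add_zero_key_ok:
  assumes "val \<rho> (lead p) = 0" "drop 1 p \<in> set K \<or> drop 1 p = []"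
  shows "table_ok \<rho> K lo hi r T \<Longrightarrow> table_ok \<rho> (p # K) lo hi ((p, lookup r (drop 1 p)) # r)
    (map (\<lambda>rr. ((p, lookup (fst rr) (drop 1 p)) # fst rr, (p, lookup (snd rr) (drop 1 p)) # snd rr)) T)"
proof -
  have *: "sign_row \<rho> K x = r \<Longrightarrow> sign_row \<rho> (p # K) x = (p, lookup r (drop 1 p)) # r" for x r
    using lookup_sign_row[OF assms(2), of \<rho> x] kpoly_drop_lead[OF assms(1)] by (auto simp: sign_row_Cons)
  show "table_ok \<rho> K lo hi r T \<Longrightarrow> ?thesis"
  proof (induction T arbitrary: lo r)
    case Nil
    then show ?case by (simp add: *)
  next
    case (Cons rr T)
    obtain r1 r2 where rr: "rr = (r1, r2)" by fastforce
    from Cons.prems obtain z where "lo < z" "z < hi" "rooted \<rho> K z"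
      "\<And>x. lo < x \<Longrightarrow> x < z \<Longrightarrow> sign_row \<rho> K x = r" "sign_row \<rho> K z = r1" "table_ok \<rho> K z hi r2 T"
      unfolding rr by auto
    with Cons.IH show ?case unfolding rr list.map fst_conv snd_conv
      by (intro table_ok_ConsI[of _ z] rooted_Cons *)
  qed
qed

text \<open>\<open>sign_table\<close> recurses on the tail, so \<open>K\<close> holds the keys
  inserted before \<open>p\<close>. What the insertion of \<open>p\<close> looks up must be there;
  \<open>[]\<close> stands for the zero polynomial.\<close>

inductive closed_keys :: "obj list list \<Rightarrow> bool" where
  "closed_keys []"
| "closed_keys K \<Longrightarrow> drop 1 p \<in> set K \<or> drop 1 p = [] \<Longrightarrow> kderiv p \<in> set K \<or> kderiv p = [] \<Longrightarrow>
    (\<And>q. q \<in> set K \<Longrightarrow> q \<noteq> [] \<Longrightarrow> prem p q \<in> set K \<or> prem p q = []) \<Longrightarrow> closed_keys (p # K)"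

lemma sign_table_ok:
  assumes "closed_keys K" "good_signs \<rho> \<Gamma> K" "lo < hi"
    "\<And>p. p \<in> set K \<Longrightarrow> val \<rho> (lead p) \<noteq> 0 \<Longrightarrow> sgn (poly (kpoly \<rho> p) hi) = sgn (val \<rho> (lead p))
      \<and> sgn (poly (kpoly \<rho> p) lo) = sgn (val \<rho> (lead p)) * (-1) ^ (length p - 1)"
  shows "table_ok \<rho> K lo hi (fst (sign_table \<Gamma> K)) (snd (sign_table \<Gamma> K))"
  using assms
proof (induction K rule: closed_keys.induct)
  case 1
  then show ?case by (simp add: sign_row_def)
next
  case (2 K p)
  have good: "good_signs \<rho> \<Gamma> K" and lp: "lookup \<Gamma> (lead p) = sgn (val \<rho> (lead p))"
    using 2 by (auto simp: good_signs_def)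
  have IH: "table_ok \<rho> K lo hi (fst (sign_table \<Gamma> K)) (snd (sign_table \<Gamma> K))"
    using 2 good by auto
  show ?case
  proof (cases "val \<rho> (lead p) = 0")
    case True
    with add_zero_key_ok[OF True 2(2) IH] lp show ?thesis by (simp add: add_key_def)
  next
    case False
    have *: "sgn (val \<rho> (lead p)) = sgn (poly (kpoly \<rho> p) hi)"
      "sgn (val \<rho> (lead p)) * (-1) ^ (length p - 1) = sgn (poly (kpoly \<rho> p) lo)"
      using 2(8)[of p] False by auto
    from False lp have "lookup \<Gamma> (lead p) \<noteq> 0" by (simp add: sgn_zero_iff)
    with extend_ok[OF False good 2(3,4) *(1) IH *(2)] lp show ?thesis
      by (simp add: add_key_def)
  qed
qed

section \<open>Computability of the sign table\<close>

lemma computable_point_sign [computable_intros]: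
  assumes "computable f" "computable g" "computable h"
  shows "computable (\<lambda>x. point_sign (f x) (g x) (h x))"
proof -
  have "computable (\<lambda>z. lead (z :: obj list))"
    unfolding lead_def by (intro computable_intros)
  note [computable_intros] = computable_comp[OF this]
  have "computable (\<lambda>z. point_sign (fst z) (fst (snd z)) (snd (snd z)))"
    unfolding point_sign_def by (intro computable_intros)
  from computable_comp3[OF this assms] show ?thesis .
qed

lemma computable_case_prod_app [computable_intros]:
  "computable (\<lambda>x. g x (fst (f x)) (snd (f x)) (h x)) \<Longrightarrow>
    computable (\<lambda>x. (case f x of (a, b) \<Rightarrow> g x a b) (h x))"
  by (simp add: case_prod_unfold)

lemma computable_Let [computable_intros]:
  "computable (\<lambda>x. g x (f x)) \<Longrightarrow> computable (\<lambda>x. Let (f x) (g x))"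
  by simp

lemma computable_extend [computable_intros]:
  assumes "computable \<Gamma>" "computable p" "computable e" "computable s" "computable r" "computable T"
  shows "computable (\<lambda>x. extend (\<Gamma> x) (p x) (e x) (s x) (r x) (T x))"
proof -
  \<comment> \<open>The arguments \<open>s\<close> and \<open>r\<close> change in the recursive
    call, so the recursion runs over the whole tuple instead of a list with a fixed
    parameter.\<close>
  let ?f = "\<lambda>(\<Gamma>, p, e, s, r, T). extend \<Gamma> p e s r T"
  let ?d = "\<lambda>(\<Gamma>, p, e, s, r, T). case T of [] \<Rightarrow> []
    | rr # T' \<Rightarrow> [(\<Gamma>, p, e, point_sign \<Gamma> p (fst rr), snd rr, T')]"
  let ?c = "\<lambda>((\<Gamma>, p, e, s, r, T), us). case T of
      [] \<Rightarrow> (if s * e = -1 then ((p, s) # r, [((p, 0) # r, (p, e) # r)])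
        else ((p, if s = 0 then e else s) # r, []))
    | rr # T' \<Rightarrow> (case us of [] \<Rightarrow> ([], []) | u # us' \<Rightarrow>
        (let t = point_sign \<Gamma> p (fst rr); rest = ((p, t) # fst rr, fst u) # snd u in
         if s * t = -1 then ((p, s) # r, ((p, 0) # r, (p, t) # r) # rest)
         else ((p, if s = 0 then t else s) # r, rest)))"
  have "computable ?f"
  proof (rule computable_rec[where d = ?d and c = ?c])
    show "computable ?d" by (intro computable_intros)
    show "computable ?c" by (intro computable_intros)
    show "wf (measure (\<lambda>(\<Gamma>, p, e, s, r, T). length T))" by simp
    show "(y, x) \<in> measure (\<lambda>(\<Gamma>, p, e, s, r, T). length T)" if "y \<in> set (?d x)" for x y
      using that by (auto split: list.splits prod.splits)
    show "?f x = ?c (x, map ?f (?d x))" for x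
      by (auto split: list.splits prod.splits simp: Let_def)
  qed
  moreover have "computable (\<lambda>x. (\<Gamma> x, p x, e x, s x, r x, T x))"
    by (intro computable_intros assms)
  ultimately show ?thesis by (auto dest: computable_comp)
qed

lemma computable_power [computable_intros]:
  fixes f :: "'a::encodable \<Rightarrow> real"
  assumes "computable f" "computable n"
  shows "computable (\<lambda>x. f x ^ n x)"
  by (rule computable_nat_recursion[OF assms(2) computable_one, where f = "\<lambda>x k. f x ^ k"
        and b = "\<lambda>x k r. f x * r"])
    (intro computable_intros computable_comp[OF assms(1)], auto)

lemma computable_sign_table [computable_intros]:
  assumes "computable f" "computable g"
  shows "computable (\<lambda>x. sign_table (f x) (g x))"
proof -
  have "computable (\<lambda>z. lead (z :: obj list))"
    unfolding lead_def by (intro computable_intros)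
  note [computable_intros] = computable_comp[OF this]
  have "computable (\<lambda>z. sign_table (fst z) (snd z))"
    by (rule computable_list_recursion[where f = "\<lambda>x. sign_table (fst x)" and l = snd and a = "\<lambda>x. ([], [])"
        and b = "\<lambda>x p K T. add_key (fst x) p T"])
      (unfold add_key_def, intro computable_intros, intro computable_intros, intro computable_intros, auto simp: add_key_def)
  from computable_comp2[OF this assms] show ?thesis .
qed

subsection \<open>A closed set of keys\<close>

text \<open>
  Keys are coefficient lists.  A state consists of the finished keys and of all keys of the next smaller
  length \<open>l\<close>.  All keys that are derived from the latter have length \<open>l - 1\<close>, even the pseudo-remainders
  of longer keys, so that one descending pass suffices.
\<close>

definition next_keys :: "obj list list \<times> obj list list \<Rightarrow> obj list list \<times> obj list list" where
  "next_keys S = (fst S @ snd S, map (drop 1) (snd S) @ map kderiv (snd S) @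
    concat (map (\<lambda>q. map (\<lambda>p. prem p q) (fst S @ snd S)) (snd S)))"

text \<open>If all members of \<open>C\<close> have length \<open>N\<close>, then after
  \<open>N\<close> rounds the pending keys have length 0, and nothing is left to derive.\<close>

definition key_closure :: "nat \<Rightarrow> obj list list \<Rightarrow> obj list list" where
  "key_closure N C = fst ((next_keys ^^ N) ([], C))"

lemma next_keys_invariant:
  assumes "\<forall>p\<in>set C. length p = N" "t \<le> N" "(next_keys ^^ t) ([], C) = (H, cur)"
  shows "(\<forall>p\<in>set cur. length p = N - t) \<and> (\<forall>p\<in>set H. N - t < length p) \<and>
    sorted_wrt (\<lambda>p q. length q \<le> length p) H \<and> set C \<subseteq> set H \<union> set cur \<and>
    (\<forall>p\<in>set H. drop 1 p \<in> set H \<union> set cur \<and> kderiv p \<in> set H \<union> set cur) \<and>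
    (\<forall>p\<in>set H. \<forall>q\<in>set H. length q \<le> length p \<longrightarrow> prem p q \<in> set H \<union> set cur)"
  using assms(2,3)
proof (induction t arbitrary: H cur)
  case 0
  then show ?case using assms(1) by auto
next
  case (Suc t)
  obtain H0 cur0 where S: "(next_keys ^^ t) ([], C) = (H0, cur0)" by fastforce
  have IH: "\<forall>p\<in>set cur0. length p = N - t" "\<forall>p\<in>set H0. N - t < length p"
    "sorted_wrt (\<lambda>p q. length q \<le> length p) H0" "set C \<subseteq> set H0 \<union> set cur0"
    "\<forall>p\<in>set H0. drop 1 p \<in> set H0 \<union> set cur0 \<and> kderiv p \<in> set H0 \<union> set cur0"
    "\<forall>p\<in>set H0. \<forall>q\<in>set H0. length q \<le> length p \<longrightarrow> prem p q \<in> set H0 \<union> set cur0"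
    using Suc.IH[OF _ S] Suc.prems(1) by auto
  have "next": "(H, cur) = next_keys (H0, cur0)" using Suc.prems(2) S by simp
  have H: "H = H0 @ cur0" and cur: "cur = map (drop 1) cur0 @ map kderiv cur0 @
    concat (map (\<lambda>q. map (\<lambda>p. prem p q) (H0 @ cur0)) cur0)"
    using "next" by (simp_all add: next_keys_def)
  have pos: "N - t > 0" using Suc.prems(1) by simp
  have "length (prem p q) = N - Suc t" if "q \<in> set cur0" "p \<in> set H0 \<union> set cur0" for p q
  proof -
    have "length q = N - t" "length q \<le> length p" using that IH(1,2) by auto
    then show ?thesis using pos by (subst length_prem) auto
  qed
  then have "\<forall>p\<in>set cur. length p = N - Suc t" unfolding cur using IH(1) by auto
  moreover have "\<forall>p\<in>set H. N - Suc t < length p" unfolding H using IH(1,2) pos by auto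
  moreover have "sorted_wrt (\<lambda>p q. length q \<le> length p) cur0"
    using IH(1) by (auto simp: sorted_wrt_iff_nth_less)
  then have "sorted_wrt (\<lambda>p q. length q \<le> length p) H"
    unfolding H using IH(1-3) by (auto simp: sorted_wrt_append intro: less_imp_le)
  moreover have "prem p q \<in> set H \<union> set cur"
    if "p \<in> set H" "q \<in> set H" "length q \<le> length p" for p q
  proof (cases "q \<in> set cur0")
    case True
    then show ?thesis using that(1) unfolding H cur by auto
  next
    case False
    then have q: "q \<in> set H0" using that(2) unfolding H by auto
    \<comment> \<open>Finished keys are longer than all pending ones, so \<open>p\<close>, being at
      least as long as the finished \<open>q\<close>, was finished as well.\<close>
    then have "p \<notin> set cur0" using IH(1,2) that(3) by force
    then have "p \<in> set H0" using that(1) unfolding H by auto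
    then show ?thesis using IH(6) q that(3) unfolding H by auto
  qed
  moreover have "set C \<subseteq> set H \<union> set cur" using IH(4) by (auto simp: H)
  moreover have "drop 1 p \<in> set H \<union> set cur \<and> kderiv p \<in> set H \<union> set cur" if "p \<in> set H" for p
  proof (cases "p \<in> set H0")
    case True
    then show ?thesis using IH(5) by (auto simp: H)
  next
    case False
    then have "p \<in> set cur0" using that by (simp add: H)
    then show ?thesis by (simp add: cur)
  qed
  ultimately show ?case by blast
qed

text \<open>Whatever is derived from \<open>p\<close> is strictly shorter than \<open>p\<close>, so
  in a list of descending lengths it occurs behind \<open>p\<close>.\<close>

lemma closed_keysI:
  assumes sorted: "sorted_wrt (\<lambda>p q. length q \<le> length p) S" and nonempty: "[] \<notin> set S"
    and *: "\<And>p. p \<in> set S \<Longrightarrow> drop 1 p \<in> insert [] (set S) \<and> kderiv p \<in> insert [] (set S)"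
      "\<And>p q. p \<in> set S \<Longrightarrow> q \<in> set S \<Longrightarrow> length q \<le> length p \<Longrightarrow> prem p q \<in> insert [] (set S)"
  shows "closed_keys S"
proof -
  have "closed_keys K" if "S = A @ K" for A K
    using that
  proof (induction K arbitrary: A)
    case (Cons p K)
    have shorter: "r \<in> set K \<or> r = []" if "r \<in> insert [] (set S)" "length r < length p" for r
      using that sorted unfolding Cons.prems by (auto simp: sorted_wrt_append)
    have p: "p \<in> set S" "p \<noteq> []" using Cons.prems nonempty by auto
    show ?case
    proof (rule closed_keys.intros(2))
      show "closed_keys K" using Cons.IH[of "A @ [p]"] Cons.prems by simp
      show "drop 1 p \<in> set K \<or> drop 1 p = []"
        by (rule shorter) (use *(1)[OF p(1)] p(2) in simp_all)
      show "kderiv p \<in> set K \<or> kderiv p = []"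
        by (rule shorter) (use *(1)[OF p(1)] p(2) in simp_all)
      fix q assume q: "q \<in> set K" "q \<noteq> []"
      then have "length q \<le> length p" "q \<in> set S"
        using sorted unfolding Cons.prems by (auto simp: sorted_wrt_append)
      moreover from this have "length (prem p q) < length p"
        using length_prem[OF q(2), of p] q(2) by (cases q) auto
      ultimately show "prem p q \<in> set K \<or> prem p q = []"
        using *(2)[OF p(1)] shorter by blast
    qed
  qed (rule closed_keys.intros)
  then show ?thesis by simp
qed

lemma key_closure:
  assumes "\<forall>p\<in>set C. length p = N"
  shows "closed_keys (key_closure N C)" "set C \<subseteq> insert [] (set (key_closure N C))"
proof -
  obtain H cur where S: "(next_keys ^^ N) ([], C) = (H, cur)" by fastforce
  note inv = next_keys_invariant[OF assms order_refl S]
  then have cur: "set cur \<subseteq> {[]}" by auto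
  show "closed_keys (key_closure N C)"
    unfolding key_closure_def S fst_conv
  proof (rule closed_keysI)
    fix p q assume "p \<in> set H" "q \<in> set H" "length q \<le> length p"
    then have "prem p q \<in> set H \<union> set cur" using inv by blast
    then show "prem p q \<in> insert [] (set H)" using cur by auto
  next
    fix p assume "p \<in> set H"
    then have "drop 1 p \<in> set H \<union> set cur" "kderiv p \<in> set H \<union> set cur" using inv by blast+
    then show "drop 1 p \<in> insert [] (set H) \<and> kderiv p \<in> insert [] (set H)" using cur by auto
  qed (use inv in auto)
  show "set C \<subseteq> insert [] (set (key_closure N C))"
    unfolding key_closure_def S fst_conv using inv cur by auto
qed

section \<open>Elimination of a variable\<close>

fun coefs :: "obj \<Rightarrow> obj list" where
  "coefs (Num r) = [Num r]"
| "coefs Empty = []"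
| "coefs (Cell a p) = a # coefs p"

text \<open>\<open>coefs\<close> is ascending, hence the reversal. Vanishing leading coefficients
  pad all polynomials of a system to one length, where the descending pass of
  \<open>key_closure\<close> starts.\<close>

definition key :: "nat \<Rightarrow> obj \<Rightarrow> obj list" where
  "key N p = replicate (N - length (coefs p)) Empty @ rev (coefs p)"

lemma poly_kpoly_snoc: "poly (kpoly \<rho> (p @ [a])) x = poly (kpoly \<rho> p) x * x + val \<rho> a"
  by (induction p) (auto simp: poly_monom algebra_simps)

lemma poly_kpoly_key: "poly (kpoly \<rho> (key N p)) x = val (x # \<rho>) p"
proof -
  have "kpoly \<rho> (replicate k Empty @ l) = kpoly \<rho> l" for k l
    by (induction k) auto
  moreover have "poly (kpoly \<rho> (rev (coefs p))) x = val (x # \<rho>) p"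
    by (induction p) (auto simp: poly_kpoly_snoc poly_monom)
  ultimately show ?thesis by (simp add: key_def)
qed

type_synonym system = "(obj \<times> real) list"

definition holds :: "real list \<Rightarrow> system \<Rightarrow> bool" where
  "holds \<rho> C \<longleftrightarrow> (\<forall>(p, s)\<in>set C. sgn (val \<rho> p) = s)"

text \<open>
  The signs of the leading coefficients determine the sign table.  All of them are guessed, and a guess
  that makes the system solvable becomes a system in the remaining variables.
\<close>

fun guesses :: "obj list \<Rightarrow> system list" where
  "guesses [] = [[]]"
| "guesses (a # A) = concat (map (\<lambda>\<Gamma>. [(a, -1) # \<Gamma>, (a, 0) # \<Gamma>, (a, 1) # \<Gamma>]) (guesses A))"

lemma true_guess: "map (\<lambda>a. (a, sgn (val \<rho> a))) A \<in> set (guesses A)"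
  by (induction A) (auto simp: sgn_if)

text \<open>A guess that holds at \<rho> consists of the true signs there, so acceptance, decided
  from \<Gamma> alone, may be interpreted at \<rho>.\<close>

lemma guess_unique: "\<Gamma> \<in> set (guesses A) \<Longrightarrow> holds \<rho> \<Gamma> \<Longrightarrow> \<Gamma> = map (\<lambda>a. (a, sgn (val \<rho> a))) A"
  by (induction A arbitrary: \<Gamma>) (auto simp: holds_def)

text \<open>A common bound for the numbers of coefficients; the total is taken since it needs no
  maximum.\<close>

definition width :: "system \<Rightarrow> nat" where
  "width C = length (concat (map (\<lambda>c. coefs (fst c)) C))"

definition keys :: "system \<Rightarrow> obj list list" where
  "keys C = key_closure (width C) (map (\<lambda>c. key (width C) (fst c)) C)"

definition accepts :: "system \<Rightarrow> system \<Rightarrow> bool" where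
  "accepts C \<Gamma> \<longleftrightarrow> list_ex (\<lambda>r. list_all (\<lambda>c. lookup r (key (width C) (fst c)) = snd c) C)
     (rows (sign_table \<Gamma> (keys C)))"

definition eliminate :: "system \<Rightarrow> system list" where
  "eliminate C = filter (accepts C) (guesses (map lead (keys C)))"

section \<open>Signs near infinity\<close>

lemma sgn_poly_at_top: "\<exists>B. \<forall>x\<ge>B. sgn (poly p x) = sgn (lead_coeff p)" for p :: "real poly"
proof (cases "p = 0")
  case False
  then consider "0 < lead_coeff p" | "0 < lead_coeff (- p)"
    by (metis leading_coeff_neq_0 lead_coeff_minus linorder_neqE_linordered_idom neg_0_less_iff_less)
  then show ?thesis
  proof cases
    case 1
    then obtain B where "\<forall>x\<ge>B. lead_coeff p \<le> poly p x" using poly_pinfty_gt_lc by blast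
    with 1 show ?thesis by (intro exI[of _ B]) force
  next
    case 2
    then obtain B where "\<forall>x\<ge>B. lead_coeff (- p) \<le> poly (- p) x" using poly_pinfty_gt_lc by blast
    with 2 show ?thesis by (intro exI[of _ B]) force
  qed
qed simp

lemma sgn_poly_at_bot:
  "\<exists>B. \<forall>x\<ge>B. sgn (poly p (- x)) = sgn (lead_coeff p) * (-1) ^ degree p" for p :: "real poly"
proof -
  have "lead_coeff (p \<circ>\<^sub>p [:0, -1:]) = lead_coeff p * (-1) ^ degree p"
    by (subst lead_coeff_comp) auto
  moreover have "poly (p \<circ>\<^sub>p [:0, -1:]) x = poly p (- x)" for x
    by (simp add: poly_pcompose)
  moreover have "sgn ((-1 :: real) ^ n) = (-1) ^ n" for n
    by (cases "even n") auto
  ultimately show ?thesis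
    using sgn_poly_at_top[of "p \<circ>\<^sub>p [:0, -1:]"] by (simp add: sgn_mult)
qed

lemma sgn_poly_at_infinity:
  fixes P :: "real poly set"
  assumes "finite P"
  shows "\<exists>B>0. \<forall>p\<in>P. \<forall>x\<ge>B. sgn (poly p x) = sgn (lead_coeff p) \<and>
    sgn (poly p (- x)) = sgn (lead_coeff p) * (-1) ^ degree p"
  using assms
proof induction
  case empty
  show ?case by (auto intro: exI[of _ 1])
next
  case (insert p P)
  obtain B C D where "0 < B" "\<forall>q\<in>P. \<forall>x\<ge>B. sgn (poly q x) = sgn (lead_coeff q) \<and>
    sgn (poly q (- x)) = sgn (lead_coeff q) * (-1) ^ degree q"
    "\<forall>x\<ge>C. sgn (poly p x) = sgn (lead_coeff p)"
    "\<forall>x\<ge>D. sgn (poly p (- x)) = sgn (lead_coeff p) * (-1) ^ degree p"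
    using insert.IH sgn_poly_at_top sgn_poly_at_bot by meson
  then show ?case by (intro exI[of _ "max B (max C D)"]) auto
qed

lemma kpoly_lead:
  assumes "val \<rho> (lead p) \<noteq> 0"
  shows "lead_coeff (kpoly \<rho> p) = val \<rho> (lead p)" "degree (kpoly \<rho> p) = length p - 1"
proof -
  obtain a q where p: "p = a # q" using assms by (cases p) (auto simp: lead_def)
  then have "val \<rho> a \<noteq> 0" using assms by (simp add: lead_def)
  from rpoly_lead[OF this, of "map (val \<rho>) q"]
  show "lead_coeff (kpoly \<rho> p) = val \<rho> (lead p)" "degree (kpoly \<rho> p) = length p - 1"
    by (simp_all add: p lead_def kpoly_def del: rpoly.simps)
qed

lemma rows_sign_table:
  assumes "closed_keys K" "good_signs \<rho> \<Gamma> K"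
  shows "set (rows (sign_table \<Gamma> K)) = range (sign_row \<rho> K)"
proof -
  obtain B where "0 < B" and B: "\<And>p x. p \<in> set K \<Longrightarrow> B \<le> x \<Longrightarrow>
      sgn (poly (kpoly \<rho> p) x) = sgn (lead_coeff (kpoly \<rho> p)) \<and>
      sgn (poly (kpoly \<rho> p) (- x)) = sgn (lead_coeff (kpoly \<rho> p)) * (-1) ^ degree (kpoly \<rho> p)"
    using sgn_poly_at_infinity[of "kpoly \<rho> ` set K"] by auto
  \<comment> \<open>The added 1 puts \<open>B\<close> and \<open>- B\<close> inside the open
    interval, where they represent all points beyond them.\<close>
  let ?lo = "- (B + 1)" and ?hi = "B + 1"
  have "table_ok \<rho> K ?lo ?hi (fst (sign_table \<Gamma> K)) (snd (sign_table \<Gamma> K))"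
  proof (rule sign_table_ok[OF assms])
    fix p assume p: "p \<in> set K" "val \<rho> (lead p) \<noteq> 0"
    show "sgn (poly (kpoly \<rho> p) ?hi) = sgn (val \<rho> (lead p)) \<and>
      sgn (poly (kpoly \<rho> p) ?lo) = sgn (val \<rho> (lead p)) * (-1) ^ (length p - 1)"
      using B[OF p(1), of "B + 1"] kpoly_lead[OF p(2)] by simp
  qed (use \<open>0 < B\<close> in simp)
  then have *: "set (rows (sign_table \<Gamma> K)) = sign_row \<rho> K ` {?lo<..<?hi}"
    using set_rows by fastforce
  have "sign_row \<rho> K x \<in> sign_row \<rho> K ` {?lo<..<?hi}" for x
  proof -
    consider "x \<in> {?lo<..<?hi}" | "B \<le> x" | "B \<le> - x" by fastforce
    then show ?thesis
    proof cases
      case 2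
      then have "sign_row \<rho> K x = sign_row \<rho> K B"
        using B[of _ x] B[of _ B] by (auto simp: sign_row_def)
      then show ?thesis using \<open>0 < B\<close> by auto
    next
      case 3
      then have "sign_row \<rho> K x = sign_row \<rho> K (- B)"
        using B[of _ "- x"] B[of _ B] by (auto simp: sign_row_def)
      then show ?thesis using \<open>0 < B\<close> by auto
    qed auto
  qed
  with * show ?thesis by auto
qed

lemma length_coefs_le_width: "c \<in> set C \<Longrightarrow> length (coefs (fst c)) \<le> width C"
  unfolding width_def length_concat by (intro member_le_sum_list) auto

text \<open>Built from the true signs at \<rho>, the table lists exactly the sign vectors that occur
  on the real line, so the quantifier over \<open>x\<close> becomes a search through its
  rows.\<close>

lemma accepts_iff:
  assumes "\<Gamma> = map (\<lambda>a. (a, sgn (val \<rho> a))) (map lead (keys C))"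
  shows "accepts C \<Gamma> \<longleftrightarrow> (\<exists>x. holds (x # \<rho>) C)"
proof -
  let ?N = "width C"
  have len: "\<forall>p\<in>set (map (\<lambda>c. key ?N (fst c)) C). length p = ?N"
    using length_coefs_le_width by (auto simp: key_def)
  note closure = key_closure[OF len, folded keys_def]
  have "good_signs \<rho> \<Gamma> (keys C)"
    unfolding good_signs_def assms lookup_map by auto
  note rows = rows_sign_table[OF closure(1) this]
  have "lookup (sign_row \<rho> (keys C) x) (key ?N (fst c)) = sgn (val (x # \<rho>) (fst c))"
    if "c \<in> set C" for x c
  proof -
    \<comment> \<open>The second case means width 0: the key is the zero polynomial, for which
      \<open>lookup\<close> returns the correct default.\<close>
    have "key ?N (fst c) \<in> set (keys C) \<or> key ?N (fst c) = []" using closure(2) that by auto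
    then show ?thesis by (simp add: lookup_sign_row poly_kpoly_key)
  qed
  then show ?thesis
    unfolding accepts_def list_ex_iff list_all_iff rows holds_def by (auto 4 4)
qed

theorem eliminate: "(\<exists>\<Gamma>\<in>set (eliminate C). holds \<rho> \<Gamma>) \<longleftrightarrow> (\<exists>x. holds (x # \<rho>) C)"
proof
  assume "\<exists>\<Gamma>\<in>set (eliminate C). holds \<rho> \<Gamma>"
  then obtain \<Gamma> where \<Gamma>: "\<Gamma> \<in> set (guesses (map lead (keys C)))" "accepts C \<Gamma>" "holds \<rho> \<Gamma>"
    by (auto simp: eliminate_def)
  with accepts_iff[OF guess_unique[OF \<Gamma>(1,3)]] show "\<exists>x. holds (x # \<rho>) C" by simp
next
  assume *: "\<exists>x. holds (x # \<rho>) C"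
  let ?\<Gamma> = "map (\<lambda>a. (a, sgn (val \<rho> a))) (map lead (keys C))"
  have "accepts C ?\<Gamma>" using accepts_iff[OF refl, of C \<rho>] * by blast
  moreover have "holds \<rho> ?\<Gamma>" by (auto simp: holds_def)
  ultimately show "\<exists>\<Gamma>\<in>set (eliminate C). holds \<rho> \<Gamma>"
    unfolding eliminate_def using true_guess[of \<rho> "map lead (keys C)"] by auto
qed

text \<open>A list of systems is read as a disjunction. Each round removes the first variable, and
  after \<open>k\<close> rounds only signs of numbers remain.\<close>

definition solvable :: "nat \<Rightarrow> system \<Rightarrow> bool" where
  "solvable k C \<longleftrightarrow> list_ex (list_all (\<lambda>c. sgn (val [] (fst c)) = snd c))
     (((\<lambda>L. concat (map eliminate L)) ^^ k) [C])"

lemma solvable_iff: "solvable k C \<longleftrightarrow> (\<exists>\<rho>. length \<rho> = k \<and> holds \<rho> C)"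
proof -
  have "(\<exists>D\<in>set (((\<lambda>L. concat (map eliminate L)) ^^ k) L). holds [] D)
      \<longleftrightarrow> (\<exists>\<rho>. length \<rho> = k \<and> (\<exists>D\<in>set L. holds \<rho> D))" for L
  proof (induction k arbitrary: L)
    case (Suc k)
    have "(\<exists>D\<in>set (((\<lambda>L. concat (map eliminate L)) ^^ Suc k) L). holds [] D)
      \<longleftrightarrow> (\<exists>\<rho>. length \<rho> = k \<and> (\<exists>D\<in>set (concat (map eliminate L)). holds \<rho> D))"
      unfolding funpow_Suc_right o_def by (rule Suc.IH)
    also have "\<dots> \<longleftrightarrow> (\<exists>\<rho>. length \<rho> = k \<and> (\<exists>C\<in>set L. \<exists>x. holds (x # \<rho>) C))"
      using eliminate by fastforce
    also have "\<dots> \<longleftrightarrow> (\<exists>\<rho>. length \<rho> = Suc k \<and> (\<exists>D\<in>set L. holds \<rho> D))"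
      unfolding length_Suc_conv by blast
    finally show ?case .
  qed simp
  from this[of "[C]"] show ?thesis
    by (simp add: solvable_def list_ex_iff list_all_iff holds_def case_prod_unfold)
qed

lemma computable_solvable [computable_intros]:
  assumes "computable f" "computable g"
  shows "computable (\<lambda>x. solvable (f x) (g x))"
proof -
  have "computable coefs"
    by (rule computable_rec[where d = "\<lambda>p. case p of Num r \<Rightarrow> [] | Empty \<Rightarrow> [] | Cell a q \<Rightarrow> [q]"
        and c = "\<lambda>w. case fst w of Num r \<Rightarrow> [Num r] | Empty \<Rightarrow> []
          | Cell a q \<Rightarrow> (case snd w of [] \<Rightarrow> [] | u # us \<Rightarrow> a # u)" and R = "measure size"])
      (intro computable_intros, intro computable_intros, auto split: obj.splits)
  note [computable_intros] = computable_comp[OF this]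
  have lead: "computable (\<lambda>z. lead (z :: obj list))"
    unfolding lead_def by (intro computable_intros)
  note [computable_intros] = computable_comp[OF this]
  have "computable (\<lambda>z. key (fst z) (snd z))"
    unfolding key_def by (intro computable_intros)
  note [computable_intros] = computable_comp2[OF this]
  have "computable width"
    unfolding width_def by (intro computable_intros)
  note [computable_intros] = computable_comp[OF this]
  have "computable (\<lambda>z. next_keys (snd z))"
    unfolding next_keys_def by (intro computable_intros)
  then have "computable (\<lambda>z. key_closure (fst z) (snd z))"
    unfolding key_closure_def by (intro computable_intros computable_funpow[where h = "\<lambda>x. next_keys"])
  note [computable_intros] = computable_comp2[OF this]
  have "computable keys"
    unfolding keys_def by (intro computable_intros)
  note [computable_intros] = computable_comp[OF this]
  have "computable rows"
    unfolding rows_def by (intro computable_intros)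
  note [computable_intros] = computable_comp[OF this]
  have "computable (\<lambda>z. accepts (fst z) (snd z))"
    unfolding accepts_def by (intro computable_intros)
  note [computable_intros] = computable_comp2[OF this]
  have "computable (\<lambda>A. guesses A)"
    by (rule computable_list_recursion[OF computable_id, where f = "\<lambda>x. guesses" and a = "\<lambda>x. [[]]"
        and b = "\<lambda>x a A r. concat (map (\<lambda>\<Gamma>. [(a, -1) # \<Gamma>, (a, 0) # \<Gamma>, (a, 1) # \<Gamma>]) r)"])
      (intro computable_intros, intro computable_intros, auto)
  note [computable_intros] = computable_comp[OF this]
  have "computable eliminate"
    unfolding eliminate_def by (intro computable_intros)
  note [computable_intros] = computable_comp[OF this]
  have sgn: "sgn x = s \<longleftrightarrow> (if x < 0 then s = -1 else if x = 0 then s = 0 else s = 1)" for x s :: real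
    by (auto simp: sgn_if)
  have "computable (\<lambda>z. solvable (fst z) (snd z))"
    unfolding solvable_def sgn
    by (intro computable_intros computable_funpow[where h = "\<lambda>x L. concat (map eliminate L)"])
  from computable_comp2[OF this assms] show ?thesis .
qed

section \<open>Rank and one-sided inverses\<close>

lemma mult_mat_unit_vec:
  fixes A :: "'a::semiring_1 mat"
  assumes "A \<in> carrier_mat n k" "i < k"
  shows "A *\<^sub>v unit_vec k i = col A i"
  using assms by (intro eq_vecI) auto

text \<open>The Gram matrix G = A^T A is invertible, since G v = 0 gives |A v|^2 = 0 over the reals;
  the left inverse is G^(-1) A^T.\<close>

lemma left_inverse_exists:
  fixes A :: "real mat"
  assumes A: "A \<in> carrier_mat n r"
    and inj: "\<And>v. v \<in> carrier_vec r \<Longrightarrow> A *\<^sub>v v = 0\<^sub>v n \<Longrightarrow> v = 0\<^sub>v r"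
  obtains L where "L \<in> carrier_mat r n" "L * A = 1\<^sub>m r"
proof -
  let ?T = "transpose_mat A"
  define G where "G = ?T * A"
  have T: "?T \<in> carrier_mat r n" and G: "G \<in> carrier_mat r r" using A by (auto simp: G_def)
  have "det G \<noteq> 0"
  proof
    assume "det G = 0"
    then obtain v where v: "v \<in> carrier_vec r" "v \<noteq> 0\<^sub>v r" "G *\<^sub>v v = 0\<^sub>v r"
      using det_0_iff_vec_prod_zero_field[OF G] by blast
    define w where "w = A *\<^sub>v v"
    have w: "w \<in> carrier_vec n" using A v by (auto simp: w_def)
    have "?T *\<^sub>v w = 0\<^sub>v r" using v T A by (simp add: w_def G_def)
    then have "w \<bullet> w = 0"
      using transpose_vec_mult_scalar[OF A v(1) w] v(1) by (simp add: w_def)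
    then have "(\<Sum>i<n. w $ i * w $ i) = 0" using w by (simp add: scalar_prod_def lessThan_atLeast0)
    then have "\<forall>i<n. w $ i = 0" by (subst (asm) sum_nonneg_eq_0_iff) auto
    then have "w = 0\<^sub>v n" using w by (intro eq_vecI) auto
    with inj v show False by (auto simp: w_def)
  qed
  from det_non_zero_imp_unit[OF G this, unfolded Units_def, of "()"]
  obtain H where H: "H \<in> carrier_mat r r" "H * G = 1\<^sub>m r" by (auto simp: ring_mat_def)
  show ?thesis
  proof (rule that)
    show "H * ?T \<in> carrier_mat r n" using H T by simp
    show "H * ?T * A = 1\<^sub>m r" using H(2) assoc_mult_mat[OF H(1) T A] by (simp add: G_def)
  qed
qed

text \<open>In a maximal independent set of columns, those that occur only at indices in
  \<open>I\<close> number at most \<open>m\<close>. Listing them first leaves columns outside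
  \<open>I\<close> at all positions from \<open>m\<close> on. \<open>L\<close> comes from a left
  inverse of the matrix of the chosen columns.\<close>

lemma independent_columns:
  fixes M :: "real mat"
  assumes M: "M \<in> carrier_mat n k" and rank: "vec_space.rank n M = r"
    and I: "I \<subseteq> {..<k}" "card I \<le> m"
  shows "\<exists>\<sigma> L. (\<forall>b<r. \<sigma> b < k) \<and> (\<forall>b<r. m \<le> b \<longrightarrow> \<sigma> b \<notin> I) \<and>
    (\<forall>a<r. \<forall>b<r. (\<Sum>p<n. M $$ (p, \<sigma> a) * L p b) = (if a = b then 1 else 0))"
proof -
  interpret vec_space "TYPE(real)" n .
  obtain S where S: "finite S" "maximal S (\<lambda>T. T \<subseteq> set (cols M) \<and> lin_indpt T)"
    using maximal_exists_superset[of "set (cols M)" "\<lambda>T. T \<subseteq> set (cols M) \<and> lin_indpt T" "{}"]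
    by (auto simp: lin_dep_def)
  then have card: "card S = r" and SM: "S \<subseteq> set (cols M)" and indep: "lin_indpt S"
    using rank_card_indpt[OF M S(2)] rank by (auto simp: maximal_def)
  define S1 where "S1 = S \<inter> col M ` ({..<k} - I)"
  have cols: "set (cols M) = col M ` {..<k}" using M by (auto simp: cols_def)
  have "S - S1 \<subseteq> col M ` I" using SM unfolding S1_def cols by auto
  moreover have "finite I" using I(1) finite_subset by blast
  ultimately have "card (S - S1) \<le> m"
    using I(2) by (meson card_image_le card_mono finite_imageI le_trans)
  obtain xs ys where xs: "set xs = S - S1" "distinct xs" and ys: "set ys = S1" "distinct ys"
    using finite_distinct_list S(1) S1_def by (metis finite_Diff finite_Int)
  let ?zs = "xs @ ys"
  have zs: "distinct ?zs" "set ?zs = S" using xs ys by (auto simp: S1_def)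
  have len: "length ?zs = r" using distinct_card[OF zs(1)] zs(2) card by simp
  have "length xs \<le> m" using \<open>card (S - S1) \<le> m\<close> xs distinct_card by metis
  then have "?zs ! b \<in> S1" if "m \<le> b" "b < r" for b
    using that len ys(1) by (auto simp: nth_append)
  moreover have "?zs ! b \<in> col M ` {..<k}" if "b < r" for b
    using that len zs(2) SM cols nth_mem by blast
  ultimately have "\<exists>i. i < k \<and> (m \<le> b \<longrightarrow> i \<notin> I) \<and> ?zs ! b = col M i" if "b < r" for b
    using that unfolding S1_def by (cases "m \<le> b") auto
  then obtain \<sigma> where \<sigma>: "\<And>b. b < r \<Longrightarrow> \<sigma> b < k \<and> (m \<le> b \<longrightarrow> \<sigma> b \<notin> I) \<and> ?zs ! b = col M (\<sigma> b)"
    by metis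
  have carrier: "set ?zs \<subseteq> carrier_vec n" using zs(2) SM cols_dim[of M] M by auto
  define A where "A = mat_of_cols n ?zs"
  have A: "A \<in> carrier_mat n r" and cA: "cols A = ?zs"
    using len carrier by (auto simp: A_def simp del: set_append)
  have "v = 0\<^sub>v r" if "v \<in> carrier_vec r" "A *\<^sub>v v = 0\<^sub>v n" for v
    using lin_depI[OF A that(1) _ that(2)] indep zs cA by auto
  then obtain L where L: "L \<in> carrier_mat r n" "L * A = 1\<^sub>m r"
    using left_inverse_exists[OF A] by blast
  show ?thesis
  proof (intro exI[of _ \<sigma>] exI[of _ "\<lambda>p b. L $$ (b, p)"] conjI allI impI)
    fix a b assume ab: "a < r" "b < r"
    have A': "A $$ (p, a) = M $$ (p, \<sigma> a)" if "p < n" for p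
    proof -
      have "A $$ (p, a) = col A a $ p" using A that ab by simp
      also have "col A a = col M (\<sigma> a)"
        using \<sigma>[OF ab(1)] cA A ab(1) by (metis carrier_matD(2) cols_nth)
      finally show ?thesis using M that \<sigma>[OF ab(1)] by simp
    qed
    have "(\<Sum>p<n. M $$ (p, \<sigma> a) * L $$ (b, p)) = (L * A) $$ (b, a)"
      using A L(1) ab A' by (auto simp: scalar_prod_def lessThan_atLeast0 mult.commute intro!: sum.cong)
    then show "(\<Sum>p<n. M $$ (p, \<sigma> a) * L $$ (b, p)) = (if a = b then 1 else 0)"
      using L(2) ab by simp
  qed (use \<sigma> in auto)
qed

text \<open>The left inverse makes \<open>A\<close> injective, hence of rank \<open>r\<close>; the
  two factorisations give \<open>A\<close> and \<open>M\<close> the same column space.\<close>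

lemma rank_eq_of_factors:
  fixes A :: "real mat"
  assumes A: "A \<in> carrier_mat n r" and L: "L \<in> carrier_mat r n" "L * A = 1\<^sub>m r"
    and M: "M \<in> carrier_mat n k" and X: "X \<in> carrier_mat r k" and Y: "Y \<in> carrier_mat k r"
    and MA: "M = A * X" and AM: "A = M * Y"
  shows "vec_space.rank n M = r"
proof -
  interpret vec_space "TYPE(real)" n .
  have inj: "v = 0\<^sub>v r" if "v \<in> carrier_vec r" "A *\<^sub>v v = 0\<^sub>v n" for v
  proof -
    have "v = (L * A) *\<^sub>v v" using that L by simp
    also have "\<dots> = L *\<^sub>v (A *\<^sub>v v)" using assoc_mult_mat_vec[OF L(1) A that(1)] .
    finally show ?thesis using that L by auto
  qed
  have dist: "distinct (cols A)"
  proof (rule ccontr)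
    assume "\<not> distinct (cols A)"
    then obtain i j where ij: "i < r" "j < r" "i \<noteq> j" "col A i = col A j"
      using A by (auto simp: distinct_conv_nth)
    then have "A *\<^sub>v unit_vec r i = A *\<^sub>v unit_vec r j"
      using mult_mat_unit_vec[OF A] by simp
    then have "A *\<^sub>v (unit_vec r i - unit_vec r j) = 0\<^sub>v n"
      using A by (subst mult_minus_distrib_mat_vec[OF A]) auto
    from inj[OF _ this] have "unit_vec r i - unit_vec r j = (0\<^sub>v r :: real vec)" by simp
    then have "(unit_vec r i - unit_vec r j) $ i = (0 :: real)" using ij by simp
    then show False using ij by simp
  qed
  have "lin_indpt (set (cols A))"
    using lin_depE[OF A _ dist] inj by blast
  then have "rank A = r" by (rule lin_indpt_full_rank[OF A dist])
  moreover have "span (set (cols A)) = span (set (cols M))"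
  proof -
    have "A *\<^sub>v (X *\<^sub>v v) = M *\<^sub>v v" if "v \<in> carrier_vec k" for v
      using assoc_mult_mat_vec[OF A X that] MA by simp
    moreover have "M *\<^sub>v (Y *\<^sub>v v) = A *\<^sub>v v" if "v \<in> carrier_vec r" for v
      using assoc_mult_mat_vec[OF M Y that] AM by simp
    ultimately have "{y \<in> carrier_vec n. \<exists>x\<in>carrier_vec r. A *\<^sub>v x = y}
        = {y \<in> carrier_vec n. \<exists>x\<in>carrier_vec k. M *\<^sub>v x = y}"
      using X Y by (metis (no_types, lifting) mult_mat_vec_carrier)
    then show ?thesis
      using col_space_eq[OF A] col_space_eq[OF M] A M unfolding col_space_def by simp
  qed
  ultimately show ?thesis by (simp add: rank_def)
qed

section \<open>The number of variables as a system of equations\<close>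

text \<open>The polarisation of a form, whose values on columns of \<open>M\<close> are the coefficients of the
  partial derivatives of the form composed with \<open>M\<close>.\<close>

definition bform :: "nat \<Rightarrow> (nat \<Rightarrow> nat \<Rightarrow> real) \<Rightarrow> (nat \<Rightarrow> real) \<Rightarrow> (nat \<Rightarrow> real) \<Rightarrow> real" where
  "bform d c u v = (\<Sum>p<d. \<Sum>q\<in>{p..<d}. c p q * (u p * v q + v p * u q))"

lemma bform_cong: "(\<And>p. p < d \<Longrightarrow> u p = u' p) \<Longrightarrow> (\<And>p. p < d \<Longrightarrow> v p = v' p) \<Longrightarrow> bform d c u v = bform d c u' v'"
  by (auto simp: bform_def intro!: sum.cong)

lemma bform_zero: "bform d c (\<lambda>p. 0) v = 0" "bform d c u (\<lambda>p. 0) = 0"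
  by (simp_all add: bform_def)

lemma bform_add_left: "bform d c (\<lambda>p. u p + u' p) v = bform d c u v + bform d c u' v"
  unfolding bform_def sum.distrib[symmetric] by (intro sum.cong refl) (simp add: algebra_simps)

lemma bform_mult_left: "bform d c (\<lambda>p. x * u p) v = x * bform d c u v"
  unfolding bform_def sum_distrib_left by (intro sum.cong refl) (simp add: algebra_simps)

lemma bform_sum_left: "bform d c (\<lambda>p. \<Sum>l\<in>A. x l * u l p) v = (\<Sum>l\<in>A. x l * bform d c (u l) v)"
  by (induction A rule: infinite_finite_induct)
    (simp_all add: bform_zero bform_add_left bform_mult_left)

text \<open>The derivative of a form at M \<xi> in the direction of column \<open>i\<close> of
  \<open>M\<close> is its polarisation at these two vectors; then M \<xi> is expanded in the columns
  of \<open>M\<close> by bilinearity.\<close>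

lemma partial_deriv_transform:
  assumes M: "M \<in> carrier_mat d d" and \<xi>: "\<xi> \<in> carrier_vec d" and i: "i < d"
  shows "partial_deriv d i (transform n M' M (\<lambda>k. quad_form d (c k)) j) \<xi>
    = (\<Sum>l<d. \<xi> $ l * (\<Sum>k<n. M' $$ (j, k) * bform d (c k) (\<lambda>p. M $$ (p, l)) (\<lambda>p. M $$ (p, i))))"
proof -
  define x where "x p = (M *\<^sub>v \<xi>) $ p" for p
  have M\<xi>: "(M *\<^sub>v (\<xi> + t \<cdot>\<^sub>v unit_vec d i)) $ p = x p + t * M $$ (p, i)" if "p < d" for t p
  proof -
    have "M *\<^sub>v (\<xi> + t \<cdot>\<^sub>v unit_vec d i) = M *\<^sub>v \<xi> + t \<cdot>\<^sub>v col M i"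
      using M \<xi> i by (simp add: mult_add_distrib_mat_vec[OF M] mult_mat_vec[OF M] mult_mat_unit_vec[OF M])
    then show ?thesis using M \<xi> i that by (simp add: x_def)
  qed
  have "((\<lambda>t. \<Sum>k<n. M' $$ (j, k) * (\<Sum>p<d. \<Sum>q\<in>{p..<d}. c k p q * ((x p + t * M $$ (p, i)) * (x q + t * M $$ (q, i)))))
    has_field_derivative (\<Sum>k<n. M' $$ (j, k) * bform d (c k) x (\<lambda>p. M $$ (p, i)))) (at 0)"
    unfolding bform_def
    by (intro DERIV_sum DERIV_cmult) (auto intro!: derivative_eq_intros simp: algebra_simps)
  moreover have "(\<lambda>t. \<Sum>k<n. M' $$ (j, k) * (\<Sum>p<d. \<Sum>q\<in>{p..<d}. c k p q * ((x p + t * M $$ (p, i)) * (x q + t * M $$ (q, i)))))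
    = (\<lambda>t. transform n M' M (\<lambda>k. quad_form d (c k)) j (\<xi> + t \<cdot>\<^sub>v unit_vec d i))"
    unfolding transform_def quad_form_def
    by (simp add: M\<xi> mult.assoc cong: sum.cong_simp)
  ultimately have "((\<lambda>t. transform n M' M (\<lambda>k. quad_form d (c k)) j (\<xi> + t \<cdot>\<^sub>v unit_vec d i))
    has_field_derivative (\<Sum>k<n. M' $$ (j, k) * bform d (c k) x (\<lambda>p. M $$ (p, i)))) (at 0)"
    by (simp only:)
  from DERIV_imp_deriv[OF this] have "partial_deriv d i (transform n M' M (\<lambda>k. quad_form d (c k)) j) \<xi>
    = (\<Sum>k<n. M' $$ (j, k) * bform d (c k) x (\<lambda>p. M $$ (p, i)))"
    unfolding partial_deriv_def .
  also have "\<dots> = (\<Sum>k<n. M' $$ (j, k) * (\<Sum>l<d. \<xi> $ l * bform d (c k) (\<lambda>p. M $$ (p, l)) (\<lambda>p. M $$ (p, i))))"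
  proof -
    have "x p = (\<Sum>l<d. \<xi> $ l * M $$ (p, l))" if "p < d" for p
      using M \<xi> that by (auto simp: x_def scalar_prod_def lessThan_atLeast0 mult.commute intro!: sum.cong)
    then have "bform d (c k) x v = bform d (c k) (\<lambda>p. \<Sum>l<d. \<xi> $ l * M $$ (p, l)) v" for k v
      by (intro bform_cong) auto
    then show ?thesis by (simp add: bform_sum_left)
  qed
  also have "\<dots> = (\<Sum>l<d. \<xi> $ l * (\<Sum>k<n. M' $$ (j, k) * bform d (c k) (\<lambda>p. M $$ (p, l)) (\<lambda>p. M $$ (p, i))))"
    unfolding sum_distrib_left by (subst sum.swap) (simp add: mult_ac)
  finally show ?thesis .
qed

text \<open>A linear form in \<xi> vanishes identically exactly if its coefficients do, and unit
  vectors read these off.\<close>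

lemma NV_transform:
  assumes M: "M \<in> carrier_mat d d"
  shows "NV d n (transform n M' M (\<lambda>k. quad_form d (c k))) = card {i. i < d \<and>
    (\<exists>j<n. \<exists>l<d. (\<Sum>k<n. M' $$ (j, k) * bform d (c k) (\<lambda>p. M $$ (p, l)) (\<lambda>p. M $$ (p, i))) \<noteq> 0)}"
proof -
  let ?B = "\<lambda>j l i. \<Sum>k<n. M' $$ (j, k) * bform d (c k) (\<lambda>p. M $$ (p, l)) (\<lambda>p. M $$ (p, i))"
  have "(\<exists>\<xi>\<in>carrier_vec d. partial_deriv d i (transform n M' M (\<lambda>k. quad_form d (c k)) j) \<xi> \<noteq> 0)
      \<longleftrightarrow> (\<exists>l<d. ?B j l i \<noteq> 0)" if i: "i < d" for i j
  proof
    assume "\<exists>\<xi>\<in>carrier_vec d. partial_deriv d i (transform n M' M (\<lambda>k. quad_form d (c k)) j) \<xi> \<noteq> 0"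
    then obtain \<xi> :: "real vec" where "(\<Sum>l<d. \<xi> $ l * ?B j l i) \<noteq> 0"
      using partial_deriv_transform[OF M _ i] by auto
    then show "\<exists>l<d. ?B j l i \<noteq> 0" by (metis (no_types, lifting) lessThan_iff mult_zero_right sum.neutral)
  next
    assume "\<exists>l<d. ?B j l i \<noteq> 0"
    then obtain l where l: "l < d" "?B j l i \<noteq> 0" by auto
    have "(\<Sum>m<d. unit_vec d l $ m * ?B j m i) = (\<Sum>m<d. if m = l then ?B j m i else 0)"
      using l(1) by (intro sum.cong) auto
    also have "\<dots> = ?B j l i" using l(1) by simp
    finally have "partial_deriv d i (transform n M' M (\<lambda>k. quad_form d (c k)) j) (unit_vec d l) \<noteq> 0"
      using l(2) partial_deriv_transform[OF M _ i, of "unit_vec d l"] by simp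
    then show "\<exists>\<xi>\<in>carrier_vec d. partial_deriv d i (transform n M' M (\<lambda>k. quad_form d (c k)) j) \<xi> \<noteq> 0"
      by (intro bexI[of _ "unit_vec d l"]) auto
  qed
  then show ?thesis unfolding NV_def by (intro arg_cong[of _ _ card]) blast
qed

definition right_inverse :: "nat \<Rightarrow> nat \<Rightarrow> (nat \<Rightarrow> nat \<Rightarrow> real) \<Rightarrow> (nat \<Rightarrow> nat \<Rightarrow> real) \<Rightarrow> bool" where
  "right_inverse r s U L \<longleftrightarrow> (\<forall>a<r. \<forall>b<r. (\<Sum>p<s. U a p * L p b) = (if a = b then 1 else 0))"

text \<open>
  The rows of \<open>U\<close> are a basis of the image of \<open>M\<close> and those of \<open>N\<close> a basis of the row space of \<open>M'\<close>.
  All but \<open>m\<close> elements of the former lie in the common kernel of the restricted forms.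
\<close>

definition reducible :: "nat \<Rightarrow> nat \<Rightarrow> nat \<Rightarrow> nat \<Rightarrow> nat \<Rightarrow> (nat \<Rightarrow> nat \<Rightarrow> nat \<Rightarrow> real) \<Rightarrow> bool" where
  "reducible d n d' n' m c \<longleftrightarrow> (\<exists>U L N R. right_inverse d' d U L \<and> right_inverse n' n N R \<and>
    (\<forall>a<d'. \<forall>b\<in>{m..<d'}. \<forall>j<n'. (\<Sum>k<n. N j k * bform d (c k) (U a) (U b)) = 0))"

text \<open>The rows of \<open>U\<close> become the first columns of \<open>M\<close> and the rows
  of \<open>N\<close> the first rows of \<open>M'\<close>, with zeros elsewhere; then no variable of
  index \<open>m\<close> or more occurs.\<close>

lemma reducible_imp_NV_le:
  assumes "reducible d n d' n' m c" "d' \<le> d" "n' \<le> n"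
  obtains M M' where "M \<in> rank_mats d d'" "M' \<in> rank_mats n n'"
    "NV d n (transform n M' M (\<lambda>k. quad_form d (c k))) \<le> m"
proof -
  obtain U L N R where U: "right_inverse d' d U L" and N: "right_inverse n' n N R"
    and z: "\<And>a b j. a < d' \<Longrightarrow> m \<le> b \<Longrightarrow> b < d' \<Longrightarrow> j < n' \<Longrightarrow>
      (\<Sum>k<n. N j k * bform d (c k) (U a) (U b)) = 0"
    using assms(1) by (auto simp: reducible_def)
  define M where "M = mat d d (\<lambda>(p, i). if i < d' then U i p else 0)"
  define M' where "M' = mat n n (\<lambda>(j, k). if j < n' then N j k else 0)"
  have M: "M \<in> carrier_mat d d" and M': "M' \<in> carrier_mat n n" by (auto simp: M_def M'_def)
  have "vec_space.rank d M = d'"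
  proof (rule rank_eq_of_factors[OF _ _ _ M])
    let ?A = "mat d d' (\<lambda>(p, i). U i p)" and ?L = "mat d' d (\<lambda>(b, p). L p b)"
    show "?A \<in> carrier_mat d d'" "?L \<in> carrier_mat d' d" by auto
    show "?L * ?A = 1\<^sub>m d'"
      using U by (intro eq_matI) (auto simp: right_inverse_def scalar_prod_def lessThan_atLeast0 mult.commute)
    let ?X = "mat d' d (\<lambda>(a, i). if a = i then 1 else 0) :: real mat"
    let ?Y = "mat d d' (\<lambda>(i, a). if a = i then 1 else 0) :: real mat"
    show "?X \<in> carrier_mat d' d" "?Y \<in> carrier_mat d d'" by auto
    show "M = ?A * ?X"
      by (intro eq_matI) (auto simp: M_def scalar_prod_def mult_delta_right)
    show "?A = M * ?Y"
      using assms(2) by (intro eq_matI) (auto simp: M_def scalar_prod_def mult_delta_right)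
  qed
  then have 1: "M \<in> rank_mats d d'" using M by (simp add: rank_mats_def)
  have "vec_space.rank n M' = n'"
  proof (rule rank_eq_of_factors[OF _ _ _ M'])
    \<comment> \<open>As \<open>N\<close> supplies rows, the injective factor is here the inclusion
      of the first \<open>n'\<close> coordinates, and the right inverse \<open>R\<close> recovers it
      from \<open>M'\<close>.\<close>
    let ?A = "mat n n' (\<lambda>(j, a). if a = j then 1 else 0) :: real mat"
    let ?L = "mat n' n (\<lambda>(a, j). if a = j then 1 else 0) :: real mat"
    let ?X = "mat n' n (\<lambda>(j, k). N j k)" and ?Y = "mat n n' (\<lambda>(k, b). R k b)"
    show "?A \<in> carrier_mat n n'" "?L \<in> carrier_mat n' n" "?X \<in> carrier_mat n' n" "?Y \<in> carrier_mat n n'"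
      by auto
    show "?L * ?A = 1\<^sub>m n'"
      using assms(3) by (intro eq_matI) (auto simp: scalar_prod_def mult_delta_left cong: if_cong)
    show "M' = ?A * ?X"
      by (intro eq_matI) (auto simp: M'_def scalar_prod_def mult_delta_left)
    show "?A = M' * ?Y"
    proof (rule eq_matI)
      fix i j assume "i < dim_row (M' * ?Y)" "j < dim_col (M' * ?Y)"
      then have "i < n" "j < n'" by (auto simp: M'_def)
      then show "?A $$ (i, j) = (M' * ?Y) $$ (i, j)"
        using N by (cases "i < n'") (auto simp: M'_def right_inverse_def scalar_prod_def lessThan_atLeast0)
    qed (auto simp: M'_def)
  qed
  then have 2: "M' \<in> rank_mats n n'" using M' by (simp add: rank_mats_def)
  let ?B = "\<lambda>j l i. \<Sum>k<n. M' $$ (j, k) * bform d (c k) (\<lambda>p. M $$ (p, l)) (\<lambda>p. M $$ (p, i))"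
  have zero: "?B j l i = 0"
    if "j < n" "l < d" "i < d" "m \<le> i" for j l i
  proof -
    have col: "bform d (c k) (\<lambda>p. M $$ (p, l)) (\<lambda>p. M $$ (p, i))
      = bform d (c k) (if l < d' then U l else (\<lambda>p. 0)) (if i < d' then U i else (\<lambda>p. 0))" for k
      using that by (intro bform_cong) (auto simp: M_def)
    show ?thesis
    proof (cases "j < n' \<and> l < d' \<and> i < d'")
      case True
      then show ?thesis unfolding col using that z[of l i j] by (simp add: M'_def)
    next
      case False
      then show ?thesis unfolding col using that
        by (intro sum.neutral) (auto simp: M'_def bform_zero)
    qed
  qed
  have "{i. i < d \<and> (\<exists>j<n. \<exists>l<d. ?B j l i \<noteq> 0)} \<subseteq> {..<m}"
  proof
    fix i assume "i \<in> {i. i < d \<and> (\<exists>j<n. \<exists>l<d. ?B j l i \<noteq> 0)}"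
    then obtain j l where a: "i < d" "j < n" "l < d" "?B j l i \<noteq> 0" by blast
    have "\<not> m \<le> i" using zero[OF a(2,3,1)] a(4) by blast
    then show "i \<in> {..<m}" by simp
  qed
  from card_mono[OF finite_lessThan this] have "NV d n (transform n M' M (\<lambda>k. quad_form d (c k))) \<le> m"
    unfolding NV_transform[OF M] by (simp only: card_lessThan)
  with 1 2 that show thesis by blast
qed

text \<open>For \<open>M\<close>, columns outside the set \<open>I\<close> of occurring variables
  are chosen, apart from at most \<open>m\<close>. For \<open>M'\<close>, any independent columns
  \<tau> will do; a left inverse of these, applied to \<open>M'\<close>, produces the row
  combinations \<open>N\<close>.\<close>

lemma NV_le_imp_reducible:
  assumes "M \<in> rank_mats d d'" "M' \<in> rank_mats n n'"
    and NV: "NV d n (transform n M' M (\<lambda>k. quad_form d (c k))) \<le> m"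
  shows "reducible d n d' n' m c"
proof -
  have M: "M \<in> carrier_mat d d" "vec_space.rank d M = d'"
    and M': "M' \<in> carrier_mat n n" "vec_space.rank n M' = n'"
    using assms(1,2) by (auto simp: rank_mats_def)
  let ?B = "\<lambda>j l i. \<Sum>k<n. M' $$ (j, k) * bform d (c k) (\<lambda>p. M $$ (p, l)) (\<lambda>p. M $$ (p, i))"
  define I where "I = {i. i < d \<and> (\<exists>j<n. \<exists>l<d. ?B j l i \<noteq> 0)}"
  have I: "I \<subseteq> {..<d}" "card I \<le> m" using NV unfolding NV_transform[OF M(1)] I_def by auto
  obtain \<sigma> L where \<sigma>: "\<And>b. b < d' \<Longrightarrow> \<sigma> b < d" "\<And>b. m \<le> b \<Longrightarrow> b < d' \<Longrightarrow> \<sigma> b \<notin> I"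
    and L: "\<And>a b. a < d' \<Longrightarrow> b < d' \<Longrightarrow> (\<Sum>p<d. M $$ (p, \<sigma> a) * L p b) = (if a = b then 1 else 0)"
    using independent_columns[OF M I] by blast
  obtain \<tau> K where \<tau>: "\<And>b. b < n' \<Longrightarrow> \<tau> b < n"
    and K: "\<And>a b. a < n' \<Longrightarrow> b < n' \<Longrightarrow> (\<Sum>p<n. M' $$ (p, \<tau> a) * K p b) = (if a = b then 1 else 0)"
    using independent_columns[OF M' empty_subsetI, of 0] by simp blast
  define U where "U a p = M $$ (p, \<sigma> a)" for a p
  define N where "N j k = (\<Sum>i<n. K i j * M' $$ (i, k))" for j k
  have "right_inverse d' d U L" using L by (simp add: right_inverse_def U_def)
  \<comment> \<open>\<open>N\<close> restricted to the columns \<tau> is the identity, so selecting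
    these columns is a right inverse.\<close>
  moreover have "right_inverse n' n N (\<lambda>k b. if k = \<tau> b then 1 else 0)"
    using K \<tau> by (auto simp: right_inverse_def N_def mult.commute if_distrib cong: if_cong)
  moreover have "(\<Sum>k<n. N j k * bform d (c k) (U a) (U b)) = 0"
    if "a < d'" "b \<in> {m..<d'}" "j < n'" for a b j
  proof -
    have "(\<Sum>k<n. N j k * bform d (c k) (U a) (U b)) = (\<Sum>i<n. K i j * ?B i (\<sigma> a) (\<sigma> b))"
      unfolding N_def U_def sum_distrib_right sum_distrib_left by (subst sum.swap) (simp add: mult.assoc)
    also have "\<dots> = 0"
      using \<sigma>(1)[OF that(1)] \<sigma>(1,2)[of b] that by (intro sum.neutral) (auto simp: I_def)
    finally show ?thesis .
  qed
  ultimately show ?thesis unfolding reducible_def by blast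
qed

text \<open>With \<open>m = d'\<close> the kernel condition is empty and coordinate vectors suffice.
  This yields both the nonemptiness of the sets of matrices and the bound \<open>d'\<close> on the
  infimum.\<close>

lemma reducible_trivial:
  assumes "d' \<le> d" "n' \<le> n"
  shows "reducible d n d' n' d' c"
proof -
  let ?E = "\<lambda>a b :: nat. if a = b then 1 else 0 :: real"
  have "right_inverse d' d ?E ?E" "right_inverse n' n ?E ?E"
    using assms by (auto simp: right_inverse_def if_distrib cong: if_cong)
  then show ?thesis unfolding reducible_def by fastforce
qed

lemma frakd_le_iff:
  assumes "d' \<le> d" "n' \<le> n"
  shows "frakd d n d' n' (\<lambda>k. quad_form d (c k)) \<le> m \<longleftrightarrow> reducible d n d' n' m c"
proof -
  let ?f = "\<lambda>M M'. NV d n (transform n M' M (\<lambda>k. quad_form d (c k)))"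
  have nonempty: "rank_mats d d' \<noteq> {}" "rank_mats n n' \<noteq> {}"
    using reducible_imp_NV_le[OF reducible_trivial[OF assms] assms] by blast+
  show ?thesis
  proof
    assume *: "frakd d n d' n' (\<lambda>k. quad_form d (c k)) \<le> m"
    have "frakd d n d' n' (\<lambda>k. quad_form d (c k)) \<in> (\<lambda>M. INF M'\<in>rank_mats n n'. ?f M M') ` rank_mats d d'"
      unfolding frakd_def using nonempty by (intro Inf_nat_def1) auto
    then obtain M where M: "M \<in> rank_mats d d'"
      "frakd d n d' n' (\<lambda>k. quad_form d (c k)) = (INF M'\<in>rank_mats n n'. ?f M M')" by auto
    have "(INF M'\<in>rank_mats n n'. ?f M M') \<in> ?f M ` rank_mats n n'"
      using nonempty by (intro Inf_nat_def1) auto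
    then obtain M' where "M' \<in> rank_mats n n'" "(INF M'\<in>rank_mats n n'. ?f M M') = ?f M M'" by auto
    with M * show "reducible d n d' n' m c" using NV_le_imp_reducible by metis
  next
    assume "reducible d n d' n' m c"
    then obtain M M' where M: "M \<in> rank_mats d d'" "M' \<in> rank_mats n n'" "?f M M' \<le> m"
      using reducible_imp_NV_le assms by metis
    have "frakd d n d' n' (\<lambda>k. quad_form d (c k)) \<le> (INF M'\<in>rank_mats n n'. ?f M M')"
      unfolding frakd_def by (rule cINF_lower[OF _ M(1)]) simp
    also have "\<dots> \<le> ?f M M'" by (rule cINF_lower[OF _ M(2)]) simp
    finally show "frakd d n d' n' (\<lambda>k. quad_form d (c k)) \<le> m" using M(3) by simp
  qed
qed

section \<open>The algorithm\<close>

text \<open>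
  The unknowns \<open>U\<close>, \<open>L\<close>, \<open>N\<close>, \<open>R\<close> of \<open>reducible\<close> are stored one after the other, each matrix row by row.
\<close>

definition mvar :: "nat \<Rightarrow> nat \<Rightarrow> nat \<Rightarrow> nat \<Rightarrow> obj" where
  "mvar off s a p = pvar (off + (a * s + p))"

definition inverse_eqs :: "nat \<Rightarrow> nat \<Rightarrow> nat \<Rightarrow> nat \<Rightarrow> obj list" where
  "inverse_eqs off off' r s = concat (map (\<lambda>a. map (\<lambda>b.
     padd (psum (map (\<lambda>p. pmul (mvar off s a p) (mvar off' r p b)) [0..<s])) (Num (if a = b then -1 else 0)))
     [0..<r]) [0..<r])"

text \<open>Row \<open>p\<close> of a coefficient table starts at the diagonal, hence the index
  \<open>q - p\<close>.\<close>

definition bform_poly :: "nat \<Rightarrow> real list list list \<Rightarrow> nat \<Rightarrow> nat \<Rightarrow> nat \<Rightarrow> obj" where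
  "bform_poly d cs k a b = psum (map (\<lambda>p. psum (map (\<lambda>q.
     pmul (Num (nth_default 0 (nth_default [] (nth_default [] cs k) p) (q - p)))
       (padd (pmul (mvar 0 d a p) (mvar 0 d b q)) (pmul (mvar 0 d b p) (mvar 0 d a q)))) [p..<d])) [0..<d])"

definition kernel_eqs :: "nat \<Rightarrow> nat \<Rightarrow> nat \<Rightarrow> nat \<Rightarrow> nat \<Rightarrow> real list list list \<Rightarrow> nat \<Rightarrow> obj list" where
  "kernel_eqs d n d' n' m cs off = concat (map (\<lambda>a. concat (map (\<lambda>b. map (\<lambda>j.
     psum (map (\<lambda>k. pmul (mvar off n j k) (bform_poly d cs k a b)) [0..<n])) [0..<n']) [m..<d'])) [0..<d'])"

text \<open>With D = d' d, the offsets are 0 for \<open>U\<close>, D for \<open>L\<close>, 2 D for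
  \<open>N\<close> and 2 D + n' n for \<open>R\<close>.\<close>

definition reducible_system :: "nat \<Rightarrow> nat \<Rightarrow> nat \<Rightarrow> nat \<Rightarrow> nat \<Rightarrow> real list list list \<Rightarrow> system" where
  "reducible_system d n d' n' m cs = map (\<lambda>p. (p, 0))
    (inverse_eqs 0 (d' * d) d' d @ inverse_eqs (2 * (d' * d)) (2 * (d' * d) + n' * n) n' n @
     kernel_eqs d n d' n' m cs (2 * (d' * d)))"

text \<open>The system is unsolvable exactly for the \<open>m\<close> below the infimum, all of
  which are below \<open>d'\<close>; counting them gives the infimum without a search.\<close>

definition frakd_algorithm :: "nat \<Rightarrow> nat \<Rightarrow> real list list list \<Rightarrow> nat \<Rightarrow> nat \<Rightarrow> nat" where
  "frakd_algorithm d n cs d' n' = length (filter (\<lambda>m.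
     \<not> solvable (2 * (d' * d) + 2 * (n' * n)) (reducible_system d n d' n' m cs)) [0..<d'])"

definition coeff_table :: "nat \<Rightarrow> nat \<Rightarrow> (nat \<Rightarrow> nat \<Rightarrow> nat \<Rightarrow> real) \<Rightarrow> real list list list" where
  "coeff_table d n c = map (\<lambda>k. map (\<lambda>i. map (\<lambda>j. c k i j) [i..<d]) [0..<d]) [0..<n]"

lemma enc_coeff_table: "enc (coeff_table d n c) = enc_coeffs d n c"
  by (simp add: enc_coeffs_def coeff_table_def enc_list_def o_def)

lemma nth_default_coeff_table:
  "k < n \<Longrightarrow> p \<le> q \<Longrightarrow> q < d \<Longrightarrow>
    nth_default 0 (nth_default [] (nth_default [] (coeff_table d n c) k) p) (q - p) = c k p q"
  by (simp add: coeff_table_def nth_default_def)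

lemma block_index: "a < r \<Longrightarrow> p < s \<Longrightarrow> a * s + p < r * (s :: nat)"
  using mult_le_mono1[of "Suc a" r s] by simp

definition mentry :: "real list \<Rightarrow> nat \<Rightarrow> nat \<Rightarrow> nat \<Rightarrow> nat \<Rightarrow> real" where
  "mentry \<rho> off s a p = \<rho> ! (off + (a * s + p))"

lemma val_mvar:
  assumes "a < r" "p < s" "off + r * s \<le> length \<rho>"
  shows "val \<rho> (mvar off s a p) = mentry \<rho> off s a p"
  using block_index[OF assms(1,2)] assms(3) by (simp add: mvar_def mentry_def val_pvar)

lemma sum_list_upt: "(\<Sum>i\<leftarrow>[m..<n]. f i) = (\<Sum>i\<in>{m..<n}. f i)"
  by (simp add: sum_list_distinct_conv_sum_set)

lemma inverse_eqs:
  assumes "off + r * s \<le> length \<rho>" "off' + r * s \<le> length \<rho>"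
  shows "(\<forall>p\<in>set (inverse_eqs off off' r s). val \<rho> p = 0) \<longleftrightarrow>
    right_inverse r s (mentry \<rho> off s) (mentry \<rho> off' r)"
proof -
  have *: "val \<rho> (psum (map (\<lambda>p. pmul (mvar off s a p) (mvar off' r p b)) [0..<s]))
      = (\<Sum>p<s. mentry \<rho> off s a p * mentry \<rho> off' r p b)" if "a < r" "b < r" for a b
    using that assms
    by (simp add: o_def sum_list_upt lessThan_atLeast0 val_mvar[of _ r] val_mvar[of _ s] mult.commute[of s r] cong: sum.cong_simp)
  show ?thesis
    unfolding inverse_eqs_def right_inverse_def
    by (auto simp: * simp del: val_psum split: if_splits)
qed

lemma val_bform_poly:
  assumes "a < d'" "b < d'" "d' * d \<le> length \<rho>" "k < n"
  shows "val \<rho> (bform_poly d (coeff_table d n c) k a b) = bform d (c k) (mentry \<rho> 0 d a) (mentry \<rho> 0 d b)"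
  unfolding bform_poly_def bform_def using assms
  by (simp add: o_def sum_list_upt lessThan_atLeast0 nth_default_coeff_table val_mvar[of _ d'] cong: sum.cong_simp)

lemma kernel_eqs:
  assumes "d' * d \<le> length \<rho>" "off + n' * n \<le> length \<rho>"
  shows "(\<forall>p\<in>set (kernel_eqs d n d' n' m (coeff_table d n c) off). val \<rho> p = 0) \<longleftrightarrow>
    (\<forall>a<d'. \<forall>b\<in>{m..<d'}. \<forall>j<n'. (\<Sum>k<n. mentry \<rho> off n j k * bform d (c k) (mentry \<rho> 0 d a) (mentry \<rho> 0 d b)) = 0)"
proof -
  have "val \<rho> (psum (map (\<lambda>k. pmul (mvar off n j k) (bform_poly d (coeff_table d n c) k a b)) [0..<n]))
      = (\<Sum>k<n. mentry \<rho> off n j k * bform d (c k) (mentry \<rho> 0 d a) (mentry \<rho> 0 d b))"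
    if "a < d'" "b < d'" "j < n'" for a b j
    using that assms
    by (simp add: o_def sum_list_upt lessThan_atLeast0 val_bform_poly val_mvar[of _ n'] cong: sum.cong_simp)
  then show ?thesis
    unfolding kernel_eqs_def by (auto simp del: val_psum)
qed

lemma mentry_exists: "\<exists>\<rho>. length \<rho> = r * s \<and> (\<forall>a<r. \<forall>p<s. mentry \<rho> 0 s a p = U a p)"
  using block_index[of _ r _ s]
  by (intro exI[of _ "map (\<lambda>i. U (i div s) (i mod s)) [0..<r * s]"]) (simp add: mentry_def)

lemma mentry_append:
  assumes "a < r" "p < s" "length \<rho> = off" "length \<rho>' = r * s"
  shows "mentry (\<rho> @ \<rho>' @ \<rho>'') off s a p = mentry \<rho>' 0 s a p"
  using block_index[OF assms(1,2)] assms(3,4) by (simp add: mentry_def nth_append)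

lemma right_inverse_cong:
  "(\<And>a p. a < r \<Longrightarrow> p < s \<Longrightarrow> U a p = U' a p) \<Longrightarrow> (\<And>p b. p < s \<Longrightarrow> b < r \<Longrightarrow> L p b = L' p b) \<Longrightarrow>
    right_inverse r s U L = right_inverse r s U' L'"
  by (simp add: right_inverse_def cong: sum.cong_simp)

lemma solvable_reducible_system:
  "solvable (2 * (d' * d) + 2 * (n' * n)) (reducible_system d n d' n' m (coeff_table d n c))
    \<longleftrightarrow> reducible d n d' n' m c"
proof -
  let ?D = "d' * d" and ?N = "n' * n"
  have *: "holds \<rho> (reducible_system d n d' n' m (coeff_table d n c)) \<longleftrightarrow>
    right_inverse d' d (mentry \<rho> 0 d) (mentry \<rho> ?D d') \<and>
    right_inverse n' n (mentry \<rho> (2 * ?D) n) (mentry \<rho> (2 * ?D + ?N) n') \<and>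
    (\<forall>a<d'. \<forall>b\<in>{m..<d'}. \<forall>j<n'. (\<Sum>k<n. mentry \<rho> (2 * ?D) n j k *
      bform d (c k) (mentry \<rho> 0 d a) (mentry \<rho> 0 d b)) = 0)"
    if "length \<rho> = 2 * ?D + 2 * ?N" for \<rho>
  proof -
    have "holds \<rho> (reducible_system d n d' n' m (coeff_table d n c)) \<longleftrightarrow>
      (\<forall>p\<in>set (inverse_eqs 0 ?D d' d). val \<rho> p = 0) \<and>
      (\<forall>p\<in>set (inverse_eqs (2 * ?D) (2 * ?D + ?N) n' n). val \<rho> p = 0) \<and>
      (\<forall>p\<in>set (kernel_eqs d n d' n' m (coeff_table d n c) (2 * ?D)). val \<rho> p = 0)"
      by (simp add: holds_def reducible_system_def ball_Un sgn_zero_iff)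
    then show ?thesis
      using that by (simp add: inverse_eqs kernel_eqs)
  qed
  show ?thesis
  proof
    assume "solvable (2 * ?D + 2 * ?N) (reducible_system d n d' n' m (coeff_table d n c))"
    with * show "reducible d n d' n' m c" unfolding solvable_iff reducible_def by blast
  next
    assume "reducible d n d' n' m c"
    then obtain U L N R where U: "right_inverse d' d U L" and N: "right_inverse n' n N R"
      and z: "\<forall>a<d'. \<forall>b\<in>{m..<d'}. \<forall>j<n'. (\<Sum>k<n. N j k * bform d (c k) (U a) (U b)) = 0"
      by (auto simp: reducible_def)
    obtain u where u: "length u = d' * d" "\<And>a p. a < d' \<Longrightarrow> p < d \<Longrightarrow> mentry u 0 d a p = U a p"
      using mentry_exists[of d' d U] by blast
    obtain l where l: "length l = d * d'" "\<And>p b. p < d \<Longrightarrow> b < d' \<Longrightarrow> mentry l 0 d' p b = L p b"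
      using mentry_exists[of d d' L] by blast
    obtain v where v: "length v = n' * n" "\<And>a p. a < n' \<Longrightarrow> p < n \<Longrightarrow> mentry v 0 n a p = N a p"
      using mentry_exists[of n' n N] by blast
    obtain r where r: "length r = n * n'" "\<And>p b. p < n \<Longrightarrow> b < n' \<Longrightarrow> mentry r 0 n' p b = R p b"
      using mentry_exists[of n n' R] by blast
    define \<rho> where "\<rho> = u @ l @ v @ r"
    have \<rho>: "length \<rho> = 2 * ?D + 2 * ?N" using u l v r by (simp add: \<rho>_def)
    have eqs: "a < d' \<Longrightarrow> p < d \<Longrightarrow> mentry \<rho> 0 d a p = U a p"
      "p < d \<Longrightarrow> a < d' \<Longrightarrow> mentry \<rho> ?D d' p a = L p a"
      "j < n' \<Longrightarrow> k < n \<Longrightarrow> mentry \<rho> (2 * ?D) n j k = N j k"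
      "k < n \<Longrightarrow> j < n' \<Longrightarrow> mentry \<rho> (2 * ?D + ?N) n' k j = R k j" for a p j k
      using mentry_append[of a d' p d "[]" 0 u "l @ v @ r"] mentry_append[of p d a d' u ?D l "v @ r"]
        mentry_append[of j n' k n "u @ l" "2 * ?D" v r] mentry_append[of k n j n' "u @ l @ v" "2 * ?D + ?N" r "[]"] u l v r
      by (simp_all add: \<rho>_def)
    have "right_inverse d' d (mentry \<rho> 0 d) (mentry \<rho> ?D d')"
      using U by (subst right_inverse_cong[where U' = U and L' = L]) (simp_all add: eqs)
    moreover have "right_inverse n' n (mentry \<rho> (2 * ?D) n) (mentry \<rho> (2 * ?D + ?N) n')"
      using N by (subst right_inverse_cong[where U' = N and L' = R]) (simp_all add: eqs)
    moreover have "(\<Sum>k<n. mentry \<rho> (2 * ?D) n j k * bform d (c k) (mentry \<rho> 0 d a) (mentry \<rho> 0 d b)) = 0"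
      if "a < d'" "b \<in> {m..<d'}" "j < n'" for a b j
    proof -
      have "bform d (c k) (mentry \<rho> 0 d a) (mentry \<rho> 0 d b) = bform d (c k) (U a) (U b)" for k
        using that by (intro bform_cong) (auto simp: eqs)
      then show ?thesis using z that by (simp add: eqs)
    qed
    ultimately show "solvable (2 * ?D + 2 * ?N) (reducible_system d n d' n' m (coeff_table d n c))"
      unfolding solvable_iff using \<rho> * by blast
  qed
qed

lemma frakd_algorithm_correct:
  assumes "d' \<le> d" "n' \<le> n"
  shows "frakd_algorithm d n (coeff_table d n c) d' n' = frakd d n d' n' (\<lambda>k. quad_form d (c k))"
proof -
  let ?r = "frakd d n d' n' (\<lambda>k. quad_form d (c k))"
  have "?r \<le> d'" using frakd_le_iff[OF assms] reducible_trivial[OF assms] by blast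
  moreover have "r \<le> k \<Longrightarrow> filter (\<lambda>m. \<not> r \<le> m) [0..<k] = [0..<r]" for r k
    by (induction k) (auto simp: le_Suc_eq not_le filter_id_conv)
  ultimately show ?thesis
    unfolding frakd_algorithm_def solvable_reducible_system frakd_le_iff[OF assms, symmetric] by simp
qed

lemma computable_frakd_algorithm:
  "computable (\<lambda>(d, n, cs, d', n'). frakd_algorithm d n cs d' n')"
  unfolding frakd_algorithm_def reducible_system_def inverse_eqs_def kernel_eqs_def bform_poly_def
    mvar_def mult_2
  by (intro computable_intros)

theorem mainTheorem5:
  shows "\<exists>P :: program. \<forall>(d::nat) (n::nat) (c :: nat \<Rightarrow> nat \<Rightarrow> nat \<Rightarrow> real) (d'::nat) (n'::nat).
    1 \<le> d \<longrightarrow> 1 \<le> n \<longrightarrow> d' \<le> d \<longrightarrow> n' \<le> n \<longrightarrow>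
      computes P [Num (real d), Num (real n), enc_coeffs d n c, Num (real d'), Num (real n')]
        (real (frakd d n d' n' (\<lambda>k. quad_form d (c k))))"
proof -
  obtain Q k where "implements Q k (\<lambda>(d, n, cs, d', n'). frakd_algorithm d n cs d' n')"
    using computable_frakd_algorithm unfolding computable_def by blast
  \<comment> \<open>Execution starts at position 0, so the body that packs the five arguments into
    one tuple comes first and everything else moves up by one.\<close>
  define b where "b = Call (Suc k) [MkCell (Var 0) (MkCell (Var 1) (MkCell (Var 2) (MkCell (Var 3) (Var 4))))]"
  let ?P = "[b] @ map (relocate (length [b])) Q"
  have P: "implements ?P (Suc k) (\<lambda>(d, n, cs, d', n'). frakd_algorithm d n cs d' n')"
    using implements_relocate[OF \<open>implements Q k _\<close>, of "[b]"] by simp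
  have "computes ?P [Num (real d), Num (real n), enc_coeffs d n c, Num (real d'), Num (real n')]
      (real (frakd d n d' n' (\<lambda>k. quad_form d (c k))))" if "d' \<le> d" "n' \<le> n" for d n c d' n'
  proof -
    let ?env = "[Num (real d), Num (real n), enc_coeffs d n c, Num (real d'), Num (real n')]"
    have var: "i < 5 \<Longrightarrow> eval ?P ?env (Var i) (?env ! i)" for i
      by (rule eval.Var) simp
    have "eval ?P ?env (MkCell (Var 0) (MkCell (Var 1) (MkCell (Var 2) (MkCell (Var 3) (Var 4)))))
      (enc (d, n, coeff_table d n c, d', n'))"
      using var[of 0] var[of 1] var[of 2] var[of 3] var[of 4]
      by (auto simp: enc_coeff_table intro!: eval.MkCell)
    from eval_Call1[OF P this] show ?thesis
      using frakd_algorithm_correct[OF that] by (simp add: computes_def b_def)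
  qed
  then show ?thesis by blast
qed

end
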